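(* Let $A$ be a smooth nonvanishing function of $u$ which is not of the form $a$ or $a(u+b)^{-2}$ with constants $a,b$, and let $\int A$ denote an antiderivative. (i) For $u_t=(A(u)u_x)_x$, every local conservation law of the united potential system $$v^1_x=u,\quad v^1_t=Au_x,\quad v^2_x=xu,\quad v^2_t=xAu_x-\textstyle\int A$$ (unknowns $u,v^1,v^2$) is trivial. (ii) For $u_t=(A(u)u_x)_x+A(u)u_x$ and $\varepsilon\in\{0,\pm1\}$, every local conservation law of the united potential system $$v^1_x=u,\quad v^1_t=Au_x+\textstyle\int A,\quad v^3_x=(e^x+\varepsilon)u,\quad v^3_t=(e^x+\varepsilon)Au_x+\varepsilon\int A$$ (unknowns $u,v^1,v^3$) is trivial.
   Context: A local conservation law of a system $\mathcal S$ in independent variables $(t,x)$ is an equation $D_tF+D_xG=0$ holding on all solutions of $\mathcal S$, with $(F,G)$ smooth functions of $t,x$ and finitely many derivatives of the unknowns. It is trivial if $F=\hat F+D_xH$, $G=\hat G-D_tH$, where $\hat F,\hat G$ vanish on the solution set of $\mathcal S$ (with its differential consequences) and $H$ is a smooth function of $t,x$ and finitely many derivatives of the unknowns. (The excluded values of $A$ correspond, modulo the equivalence group of the class $u_t=(A(u)u_x)_x+B(u)u_x$, to the linearizable equations; the paper states the theorem for the nonlinearizable equations.) *)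

theory Defs
  imports "HOL-Analysis.Analysis"
begin

text \<open>Jet space coordinates in independent variables (t,x):
  T, X, and J i k l = the derivative d_t^k d_x^l of the i-th unknown.\<close>
datatype coord = T | X | J nat nat nat

type_synonym jpt = "coord \<Rightarrow> real"

definition pd :: "coord \<Rightarrow> (jpt \<Rightarrow> real) \<Rightarrow> jpt \<Rightarrow> real" where
  "pd c F p = deriv (\<lambda>s. F (p(c := s))) (p c)"

fun pds :: "coord list \<Rightarrow> (jpt \<Rightarrow> real) \<Rightarrow> jpt \<Rightarrow> real" where
  "pds [] F = F"
| "pds (c # cs) F = pd c (pds cs F)"

fun tsh :: "coord \<Rightarrow> coord" where
  "tsh (J i k l) = J i (Suc k) l"
| "tsh c = c"

fun xsh :: "coord \<Rightarrow> coord" where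
  "xsh (J i k l) = J i k (Suc l)"
| "xsh c = c"

fun isJ :: "coord \<Rightarrow> bool" where
  "isJ (J i k l) = True"
| "isJ _ = False"

fun valid_coord :: "nat \<Rightarrow> coord \<Rightarrow> bool" where
  "valid_coord m (J i k l) = (i < m)"
| "valid_coord m _ = True"

definition Dt :: "(jpt \<Rightarrow> real) \<Rightarrow> jpt \<Rightarrow> real" where
  "Dt F p = pd T F p + (\<Sum>c\<in>{c. isJ c \<and> pd c F p \<noteq> 0}. p (tsh c) * pd c F p)"

definition Dx :: "(jpt \<Rightarrow> real) \<Rightarrow> jpt \<Rightarrow> real" where
  "Dx F p = pd X F p + (\<Sum>c\<in>{c. isJ c \<and> pd c F p \<noteq> 0}. p (xsh c) * pd c F p)"

definition jet_fun :: "nat \<Rightarrow> jpt set \<Rightarrow> (jpt \<Rightarrow> real) \<Rightarrow> bool" where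
  "jet_fun m D F \<longleftrightarrow>
     (\<exists>S. finite S \<and> S \<subseteq> {c. valid_coord m c} \<and>
        (\<forall>p\<in>D. \<forall>q\<in>D. (\<forall>c\<in>S. p c = q c) \<longrightarrow> F p = F q)) \<and>
     (\<forall>cs. continuous_on D (pds cs F) \<and>
        (\<forall>p\<in>D. \<forall>c. (\<lambda>s. pds cs F (p(c := s))) differentiable (at (p c))))"

definition sol_set :: "jpt set \<Rightarrow> (jpt \<Rightarrow> real) list \<Rightarrow> jpt set" where
  "sol_set D Es = {p \<in> D. \<forall>E\<in>set Es. \<forall>a b. (Dt ^^ a) ((Dx ^^ b) E) p = 0}"

definition conservation_law ::
  "nat \<Rightarrow> jpt set \<Rightarrow> (jpt \<Rightarrow> real) list \<Rightarrow> (jpt \<Rightarrow> real) \<Rightarrow> (jpt \<Rightarrow> real) \<Rightarrow> bool" where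
  "conservation_law m D Es F G \<longleftrightarrow> jet_fun m D F \<and> jet_fun m D G \<and>
     (\<forall>p\<in>sol_set D Es. Dt F p + Dx G p = 0)"

text \<open>Trivial: F = Fh + D_x H, G = Gh - D_t H with Fh, Gh vanishing on solutions.\<close>
definition trivial_cl ::
  "nat \<Rightarrow> jpt set \<Rightarrow> (jpt \<Rightarrow> real) list \<Rightarrow> (jpt \<Rightarrow> real) \<Rightarrow> (jpt \<Rightarrow> real) \<Rightarrow> bool" where
  "trivial_cl m D Es F G \<longleftrightarrow> (\<exists>H. jet_fun m D H \<and>
     (\<forall>p\<in>sol_set D Es. F p - Dx H p = 0 \<and> G p + Dt H p = 0))"

definition smooth_real_on :: "real set \<Rightarrow> (real \<Rightarrow> real) \<Rightarrow> bool" where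
  "smooth_real_on I A \<longleftrightarrow> (\<forall>n. \<forall>x\<in>I. ((deriv ^^ n) A) differentiable (at x))"

definition jdom :: "real set \<Rightarrow> jpt set" where
  "jdom I = {p. p (J 0 0 0) \<in> I}"

text \<open>Unknowns: J 0 = u, J 1 = v^1, J 2 = v^2 (resp. v^3).\<close>
definition usys1 :: "(real \<Rightarrow> real) \<Rightarrow> (real \<Rightarrow> real) \<Rightarrow> (jpt \<Rightarrow> real) list" where
  "usys1 A IA =
    [\<lambda>p. p (J 1 0 1) - p (J 0 0 0),
     \<lambda>p. p (J 1 1 0) - A (p (J 0 0 0)) * p (J 0 0 1),
     \<lambda>p. p (J 2 0 1) - p X * p (J 0 0 0),
     \<lambda>p. p (J 2 1 0) - (p X * A (p (J 0 0 0)) * p (J 0 0 1) - IA (p (J 0 0 0)))]"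

definition usys2 :: "(real \<Rightarrow> real) \<Rightarrow> (real \<Rightarrow> real) \<Rightarrow> real \<Rightarrow> (jpt \<Rightarrow> real) list" where
  "usys2 A IA \<epsilon> =
    [\<lambda>p. p (J 1 0 1) - p (J 0 0 0),
     \<lambda>p. p (J 1 1 0) - (A (p (J 0 0 0)) * p (J 0 0 1) + IA (p (J 0 0 0))),
     \<lambda>p. p (J 2 0 1) - (exp (p X) + \<epsilon>) * p (J 0 0 0),
     \<lambda>p. p (J 2 1 0) - ((exp (p X) + \<epsilon>) * A (p (J 0 0 0)) * p (J 0 0 1) + \<epsilon> * IA (p (J 0 0 0)))]"

end

theory Submission
  imports Defs
begin

text \<open>
  The solution set is parametrized by $t, x, v^1, v^2$ and the x-derivatives $u_l$ of u, and every
  question pulls back to functions of these. If the density $F$ has order $n \<ge> 1$ in u, then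
  $D_t F + D_x G = 0$ forces $G_{u_{n+1}} = -A F_{u_n}$ and then $F_{u_n u_n} = 0$, so that
  subtracting $D_x H$ with $H_{u_{n-1}} = F_{u_n}$ lowers the order. A density of order 0 becomes
  $F = f u$ with f depending on $t, x, v^1, v^2$ only. Now the law is a relation between
  $1, u, \<integral>A, u\<integral>A$ with coefficients free of u; these four functions are independent precisely
  because $A$ is neither constant nor $a (u+b)^{-2}$. The coefficients of $\<integral>A$ and $u\<integral>A$ say that
  $f = H_{v^1} + \<phi> H_{v^2}$ for a function H of $t, v^1, v^2$, whence $F = D_x H$. What remains
  is $D_x G = 0$, and then G depends on t alone.
\<close>

subsection \<open>Partial derivatives on the jet space\<close>

text \<open>The equation \<phi>' = \<kappa>\<phi> - \<psi>, with \<phi>' nonzero, makes 1 and \<phi>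
  span the solutions of f_xx = \<kappa> f_x. This is the condition that the coefficient of
  \<integral>A puts on a density f u; hence f = b + \<phi> a with a, b free of x, and f u = b D_x
  v^1 + a D_x v^2. The coefficient of u\<integral>A then says that b dv^1 + a dv^2 is closed, and
  the density is exact by the Poincare lemma in the plane of v^1 and v^2. Two obstacles shape the
  rest. The solution set is cut out by infinitely many equations, so a retraction onto it is built
  that turns the ambient total derivatives into derivations in the free coordinates; this needs
  those derivations to commute. And the jet space is infinite-dimensional with regularity given one
  coordinate at a time, so the chain rule, primitives with parameters and the symmetry of mixed
  derivatives are obtained from calculus in one variable.\<close>

lemma tendsto_fun_iff:
  fixes f :: "'a \<Rightarrow> 'b \<Rightarrow> 'c::topological_space"
  shows "(f \<longlongrightarrow> l) G \<longleftrightarrow> (\<forall>c. ((\<lambda>x. f x c) \<longlongrightarrow> l c) G)"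
proof -
  have "(f \<longlongrightarrow> l) G \<longleftrightarrow> limitin (product_topology (\<lambda>i. euclidean) UNIV) f l G"
    by (simp add: euclidean_product_topology)
  also have "\<dots> \<longleftrightarrow> (\<forall>c. ((\<lambda>x. f x c) \<longlongrightarrow> l c) G)"
    by (simp add: limitin_componentwise)
  finally show ?thesis .
qed

lemma pds_append: "pds (cs @ ds) F = pds cs (pds ds F)"
  by (induction cs) auto

text \<open>The action of a vector field \<xi> on F. There are infinitely many coordinates, but a
  function of finitely many of them leaves a finite sum. \<open>Dt\<close>, \<open>Dx\<close> and
  their counterparts on the solution set all have this form, so product rule, chain rule and
  commutation are proved once.\<close>

definition der :: "(coord \<Rightarrow> jpt \<Rightarrow> real) \<Rightarrow> (jpt \<Rightarrow> real) \<Rightarrow> jpt \<Rightarrow> real" where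
  "der \<xi> F p = (\<Sum>c\<in>{c. pd c F p \<noteq> 0}. \<xi> c p * pd c F p)"

definition full_t :: "coord \<Rightarrow> jpt \<Rightarrow> real" where
  "full_t c p = (case c of T \<Rightarrow> 1 | X \<Rightarrow> 0 | J i k l \<Rightarrow> p (J i (Suc k) l))"

definition full_x :: "coord \<Rightarrow> jpt \<Rightarrow> real" where
  "full_x c p = (case c of T \<Rightarrow> 0 | X \<Rightarrow> 1 | J i k l \<Rightarrow> p (J i k (Suc l)))"

text \<open>An interval I keeps segments in the u-direction inside the domain, as the mean value
  theorem and primitives require.\<close>

locale jets =
  fixes I :: "real set"
  assumes I_open: "open I" and I_interval: "is_interval I" and I_ne: "I \<noteq> {}"
begin

abbreviation D :: "jpt set" where "D \<equiv> jdom I"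

lemma in_D: "p \<in> D \<longleftrightarrow> p (J 0 0 0) \<in> I"
  by (simp add: jdom_def)

lemma upd_D: "p \<in> D \<Longrightarrow> c \<noteq> J 0 0 0 \<Longrightarrow> p(c := s) \<in> D"
  by (simp add: in_D)

definition coord_range :: "coord \<Rightarrow> real set" where
  "coord_range c = (if c = J 0 0 0 then I else UNIV)"

lemma coord_range: "open (coord_range c)" "is_interval (coord_range c)" "convex (coord_range c)" "p \<in> D \<Longrightarrow> p c \<in> coord_range c"
    "p \<in> D \<Longrightarrow> p(c := s) \<in> D \<longleftrightarrow> s \<in> coord_range c"
  using I_open I_interval by (auto simp: coord_range_def in_D is_interval_convex)

lemma coord_range_between:
  assumes "a \<in> coord_range c" "b \<in> coord_range c" "min a b \<le> x" "x \<le> max a b"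
  shows "x \<in> coord_range c"
  using mem_is_interval_1_I[OF coord_range(2), of a c b x] mem_is_interval_1_I[OF coord_range(2), of b c a x] assms
  by (auto simp: min_def max_def split: if_splits)

lemma eventually_D: "p \<in> D \<Longrightarrow> \<forall>\<^sub>F s in nhds (p c). p(c := s) \<in> D"
  by (rule eventually_mono[OF eventually_nhds_in_open[OF coord_range(1) coord_range(4)]]) (simp_all add: coord_range(5))

text \<open>\<open>pd\<close> has a value even where no derivative exists; this relation records
  existence as well.\<close>

definition has_pd :: "coord \<Rightarrow> (jpt \<Rightarrow> real) \<Rightarrow> real \<Rightarrow> jpt \<Rightarrow> bool" where
  "has_pd c F d p \<longleftrightarrow> ((\<lambda>s. F (p(c := s))) has_real_derivative d) (at (p c))"

lemma has_pd_pd: "has_pd c F d p \<Longrightarrow> pd c F p = d"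
  unfolding has_pd_def pd_def by (rule DERIV_imp_deriv)

text \<open>Agreement on D is enough because every coordinate line meets D in an open set.\<close>

lemma has_pd_cong:
  assumes "has_pd c F d p" "\<And>p. p \<in> D \<Longrightarrow> F p = G p" "p \<in> D"
  shows "has_pd c G d p"
proof -
  have ev: "\<forall>\<^sub>F s in nhds (p c). F (p(c := s)) = G (p(c := s))"
    using eventually_D[OF assms(3)] by eventually_elim (rule assms(2))
  show ?thesis
    using assms(1) DERIV_cong_ev[OF refl ev refl] by (simp add: has_pd_def)
qed

lemma pd_cong:
  assumes "\<And>p. p \<in> D \<Longrightarrow> F p = G p" "p \<in> D"
  shows "pd c F p = pd c G p"
proof -
  have "\<forall>\<^sub>F s in nhds (p c). F (p(c := s)) = G (p(c := s))"
    using eventually_D[OF assms(2)] by eventually_elim (rule assms(1))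
  then show ?thesis unfolding pd_def by (rule deriv_cong_ev) simp
qed

lemma has_pd_add: "has_pd c F a p \<Longrightarrow> has_pd c G b p \<Longrightarrow> has_pd c (\<lambda>p. F p + G p) (a + b) p"
  unfolding has_pd_def by (auto intro!: derivative_eq_intros)

lemma has_pd_mult:
  "has_pd c F a p \<Longrightarrow> has_pd c G b p \<Longrightarrow> has_pd c (\<lambda>p. F p * G p) (a * G p + F p * b) p"
  unfolding has_pd_def by (auto intro!: derivative_eq_intros)

lemma has_pd_const: "has_pd c (\<lambda>p. a) 0 p"
  unfolding has_pd_def by (auto intro!: derivative_eq_intros)

lemma has_pd_coord: "has_pd c (\<lambda>p. p d) (if c = d then 1 else 0) p"
  unfolding has_pd_def by (auto intro!: derivative_eq_intros)

lemma has_pd_fun: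
  assumes "(g has_real_derivative g') (at (p d))"
  shows "has_pd c (\<lambda>p. g (p d)) (if c = d then g' else 0) p"
  using assms unfolding has_pd_def by (auto intro!: derivative_eq_intros)

text \<open>Counting orders turns closure under products, composition and primitives into an
  induction on n: the derivative of such a function is built from functions of the same
  kinds.\<close>

fun smooth_upto :: "nat \<Rightarrow> (jpt \<Rightarrow> real) \<Rightarrow> bool" where
  "smooth_upto 0 F \<longleftrightarrow> continuous_on D F"
| "smooth_upto (Suc n) F \<longleftrightarrow> continuous_on D F \<and> (\<forall>p\<in>D. \<forall>c. has_pd c F (pd c F p) p) \<and> (\<forall>c. smooth_upto n (pd c F))"

lemma smooth_upto_cong: "(\<And>p. p \<in> D \<Longrightarrow> F p = G p) \<Longrightarrow> smooth_upto n F \<Longrightarrow> smooth_upto n G"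
proof (induction n arbitrary: F G)
  case 0
  then show ?case using continuous_on_cong[of D D F G] by simp
next
  case (Suc n)
  have "smooth_upto n (pd c G)" for c
    using Suc.IH[of "pd c F" "pd c G"] Suc.prems pd_cong[of F G] by auto
  moreover have "has_pd c G (pd c G p) p" if "p \<in> D" for c p
  proof (rule has_pd_cong)
    have "pd c F p = pd c G p" by (rule pd_cong[OF _ that]) (rule Suc.prems(1))
    then show "has_pd c F (pd c G p) p"
      using Suc.prems(2) that by (metis smooth_upto.simps(2))
  qed (use Suc.prems that in auto)
  ultimately show ?case using Suc.prems continuous_on_cong[of D D F G] by simp
qed

text \<open>The candidate derivative has to be correct on D only, so no value of \<open>pd\<close>
  off the domain is ever computed.\<close>

lemma smooth_upto_SucI:
  assumes "continuous_on D F" "\<And>p c. p \<in> D \<Longrightarrow> has_pd c F (F' c p) p" "\<And>c. smooth_upto n (F' c)"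
  shows "smooth_upto (Suc n) F"
proof -
  have "smooth_upto n (pd c F)" for c
    by (rule smooth_upto_cong[OF _ assms(3)[of c]]) (rule has_pd_pd[OF assms(2), symmetric])
  then show ?thesis using assms has_pd_pd[OF assms(2)] by simp
qed

lemma smooth_upto_Suc: "smooth_upto (Suc n) F \<Longrightarrow> smooth_upto n F"
  by (induction n arbitrary: F) auto

lemma smooth_upto_cont: "smooth_upto n F \<Longrightarrow> continuous_on D F"
  by (cases n) auto

lemma smooth_upto_const: "smooth_upto n (\<lambda>p. a)"
proof (induction n arbitrary: a)
  case (Suc n)
  show ?case by (rule smooth_upto_SucI[where F'="\<lambda>c p. 0"]) (auto simp: has_pd_const Suc)
qed simp

lemma cont_coord: "continuous_on S (\<lambda>p. p (c::'a) :: real)"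
  by (rule continuous_on_subset[OF continuous_on_product_coordinates]) simp

lemma smooth_upto_coord: "smooth_upto n (\<lambda>p. p c)"
proof (cases n)
  case (Suc n)
  have "has_pd d (\<lambda>p. p c) (if d = c then 1 else 0) p" for d p by (rule has_pd_coord)
  then show ?thesis unfolding Suc
    by (rule smooth_upto_SucI[where F'="\<lambda>d p. if d = c then 1 else 0", OF cont_coord]) (rule smooth_upto_const)
qed (simp add: cont_coord)

lemma smooth_upto_add: "smooth_upto n F \<Longrightarrow> smooth_upto n G \<Longrightarrow> smooth_upto n (\<lambda>p. F p + G p)"
proof (induction n arbitrary: F G)
  case 0
  then show ?case by (auto intro!: continuous_intros)
next
  case (Suc n)
  show ?case
    by (rule smooth_upto_SucI[where F'="\<lambda>c p. pd c F p + pd c G p"])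
       (use Suc in \<open>simp_all add: continuous_on_add has_pd_add\<close>)
qed

lemma smooth_upto_mult: "smooth_upto n F \<Longrightarrow> smooth_upto n G \<Longrightarrow> smooth_upto n (\<lambda>p. F p * G p)"
proof (induction n arbitrary: F G)
  case 0
  then show ?case by (auto intro!: continuous_intros)
next
  case (Suc n)
  have "smooth_upto n (\<lambda>p. pd c F p * G p + F p * pd c G p)" for c
    using Suc.prems smooth_upto_Suc[of n F] smooth_upto_Suc[of n G] by (intro smooth_upto_add Suc.IH) auto
  then show ?case
    by (intro smooth_upto_SucI[where F'="\<lambda>c p. pd c F p * G p + F p * pd c G p"])
       (use Suc in \<open>simp_all add: continuous_on_mult has_pd_mult\<close>)
qed

lemma smooth_upto_sum: "finite S \<Longrightarrow> (\<And>c. c \<in> S \<Longrightarrow> smooth_upto n (F c)) \<Longrightarrow> smooth_upto n (\<lambda>p. \<Sum>c\<in>S. F c p)"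
proof (induction S rule: finite_induct)
  case (insert c S)
  then show ?case using smooth_upto_add[of n "F c" "\<lambda>p. \<Sum>c\<in>S. F c p"] by simp
qed (simp add: smooth_upto_const)

definition dep :: "coord set \<Rightarrow> (jpt \<Rightarrow> real) \<Rightarrow> bool" where
  "dep S F \<longleftrightarrow> (\<forall>p\<in>D. \<forall>q\<in>D. (\<forall>c\<in>S. p c = q c) \<longrightarrow> F p = F q)"

lemma depD: "dep S F \<Longrightarrow> p \<in> D \<Longrightarrow> q \<in> D \<Longrightarrow> (\<And>c. c \<in> S \<Longrightarrow> p c = q c) \<Longrightarrow> F p = F q"
  unfolding dep_def by blast

lemma dep_pd_0:
  assumes "dep S F" "c \<notin> S" "p \<in> D"
  shows "has_pd c F 0 p"
proof -
  have ev: "\<forall>\<^sub>F s in nhds (p c). F p = F (p(c := s))"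
    using eventually_D[OF assms(3)]
    by eventually_elim (rule depD[OF assms(1,3)], use assms(2) in auto)
  show ?thesis
    using DERIV_const[of "F p" "at (p c)"] DERIV_cong_ev[OF refl ev refl] by (simp add: has_pd_def)
qed

lemma dep_pd: assumes "dep S F" shows "dep S (pd c F)"
  unfolding dep_def
proof (intro ballI impI)
  fix p q assume pq: "p \<in> D" "q \<in> D" "\<forall>c\<in>S. p c = q c"
  show "pd c F p = pd c F q"
  proof (cases "c \<in> S")
    case False
    then show ?thesis using dep_pd_0[OF assms, THEN has_pd_pd] pq by simp
  next
    case True
    then have e: "p c = q c" using pq by auto
    have "\<forall>\<^sub>F s in nhds (p c). F (p(c := s)) = F (q(c := s))"
      using eventually_D[OF pq(1)] eventually_D[OF pq(2), of c, folded e]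
      by eventually_elim (rule depD[OF assms], use pq(3) in auto)
    then show ?thesis unfolding pd_def by (rule deriv_cong_ev) (rule e)
  qed
qed

lemma dep_mono: "dep S F \<Longrightarrow> S \<subseteq> S' \<Longrightarrow> dep S' F"
  unfolding dep_def by blast

text \<open>The mean value theorem for both orders of the endpoints and for equal ones. The bound on
  the distance of z from \<open>p c\<close> is the form that the squeeze in
  \<open>chain_curve\<close> uses.\<close>

lemma pd_mvt:
  assumes F: "\<And>p. p \<in> D \<Longrightarrow> has_pd c F (pd c F p) p" and p: "p \<in> D" "p(c := s) \<in> D"
  shows "\<exists>z. \<bar>z - p c\<bar> \<le> \<bar>s - p c\<bar> \<and> p(c := z) \<in> D \<and>
      F (p(c := s)) - F p = (s - p c) * pd c F (p(c := z))"
proof -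
  let ?f = "\<lambda>s. F (p(c := s))"
  have der: "(?f has_real_derivative pd c F (p(c := z))) (at z)" if "z \<in> coord_range c" for z
    using F[of "p(c := z)"] that p by (simp add: has_pd_def coord_range)
  have in_coord_range: "p c \<in> coord_range c" "s \<in> coord_range c" using p by (auto simp: coord_range)
  have mvt: "\<exists>z. a \<le> z \<and> z \<le> b \<and> ?f b - ?f a = (b - a) * pd c F (p(c := z))"
    if ab: "a < b" "a \<in> coord_range c" "b \<in> coord_range c" for a b
  proof -
    have cr: "x \<in> coord_range c" if "a \<le> x" "x \<le> b" for x
      using coord_range_between[OF ab(2,3), of x] that by auto
    obtain z where "a < z" "z < b" "?f b - ?f a = (b - a) * pd c F (p(c := z))"
      using MVT2[OF ab(1), of ?f "\<lambda>z. pd c F (p(c := z))"] der cr by auto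
    then show ?thesis by (intro exI[of _ z]) simp
  qed
  consider "p c < s" | "s < p c" | "s = p c" by linarith
  then show ?thesis
  proof cases
    case 1
    then obtain z where "p c \<le> z" "z \<le> s" "?f s - ?f (p c) = (s - p c) * pd c F (p(c := z))"
      using mvt[of "p c" s] in_coord_range by auto
    moreover have "z \<in> coord_range c" using coord_range_between[OF in_coord_range, of z] calculation by auto
    ultimately show ?thesis using p by (intro exI[of _ z]) (auto simp: coord_range)
  next
    case 2
    then obtain z where "s \<le> z" "z \<le> p c" "?f (p c) - ?f s = (p c - s) * pd c F (p(c := z))"
      using mvt[of s "p c"] in_coord_range by auto
    moreover have "z \<in> coord_range c" using coord_range_between[OF in_coord_range, of z] calculation by auto
    ultimately show ?thesis using p by (intro exI[of _ z]) (auto simp: coord_range algebra_simps)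
  qed (use p in auto)
qed

text \<open>A chain rule without Frechet derivatives: the coordinates of the base point are replaced
  by those of the curve one at a time, each replacement is a mean value increment, and continuity of
  the partial derivatives yields the limit.\<close>

lemma chain_curve:
  assumes S: "finite S" "dep S F"
    and F: "\<And>p c. p \<in> D \<Longrightarrow> has_pd c F (pd c F p) p" "\<And>c. continuous_on D (pd c F)"
    and g: "\<And>c. c \<in> S \<Longrightarrow> ((\<lambda>s. g s c) has_real_derivative g' c) (at s0)"
    and gD: "\<forall>\<^sub>F s in nhds s0. g s \<in> D"
  shows "((\<lambda>s. F (g s)) has_real_derivative (\<Sum>c\<in>S. pd c F (g s0) * g' c)) (at s0)"
proof -
  define p0 where "p0 = g s0"
  have p0: "p0 \<in> D" using eventually_nhds_x_imp_x[OF gD] by (simp add: p0_def)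
  \<comment> \<open>On S' the jet follows the curve, elsewhere it rests at the base point; the
    induction enlarges S' up to S.\<close>
  define mix where "mix = (\<lambda>S s c. if c \<in> S then g s c else p0 c)"
  have mix0: "mix S s0 = p0" for S by (auto simp: mix_def p0_def)
  have mixD: "mix S s \<in> D" if "g s \<in> D" for S s using p0 that by (auto simp: mix_def in_D)
  have "((\<lambda>s. F (mix S' s)) has_real_derivative (\<Sum>c\<in>S'. pd c F p0 * g' c)) (at s0)"
    if "finite S'" "S' \<subseteq> S" for S'
    using that
  proof (induction S' rule: finite_induct)
    case empty
    then show ?case by (simp add: mix_def)
  next
    case (insert c S')
    have cS: "c \<in> S" "c \<notin> S'" using insert by auto
    define q where "q = mix S'"
    have q_c: "q s c = p0 c" for s using cS by (simp add: q_def mix_def)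
    have mix_ins: "mix (insert c S') s = (q s)(c := g s c)" for s
      by (auto simp: mix_def q_def)
    have "\<exists>z. g s \<in> D \<longrightarrow> \<bar>z - p0 c\<bar> \<le> \<bar>g s c - p0 c\<bar> \<and> (q s)(c := z) \<in> D \<and>
       F ((q s)(c := g s c)) - F (q s) = (g s c - p0 c) * pd c F ((q s)(c := z))" for s
      using pd_mvt[OF F(1), where p="q s" and s="g s c" and c=c] mixD[of s S'] mixD[of s "insert c S'"]
      unfolding q_c mix_ins q_def[symmetric] by blast
    then obtain z where z: "\<And>s. g s \<in> D \<Longrightarrow> \<bar>z s - p0 c\<bar> \<le> \<bar>g s c - p0 c\<bar>"
        "\<And>s. g s \<in> D \<Longrightarrow> (q s)(c := z s) \<in> D"
       "\<And>s. g s \<in> D \<Longrightarrow> F ((q s)(c := g s c)) - F (q s) = (g s c - p0 c) * pd c F ((q s)(c := z s))"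
      by metis
    have gc: "((\<lambda>s. g s d) \<longlongrightarrow> p0 d) (at s0)" if "d \<in> S" for d
      using DERIV_isCont[OF g[OF that]] by (simp add: isCont_def p0_def)
    have gD': "\<forall>\<^sub>F s in at s0. g s \<in> D"
      using gD eventually_at_filter[of _ s0 UNIV] by (auto elim: eventually_mono)
    have "((\<lambda>s. g s c - p0 c) \<longlongrightarrow> 0) (at s0)"
      using gc[OF cS(1)] by (simp add: LIM_zero)
    then have "((\<lambda>s. z s - p0 c) \<longlongrightarrow> 0) (at s0)"
      by (rule Lim_null_comparison[rotated, OF tendsto_rabs_zero])
         (use gD' in eventually_elim, use z(1) in auto)
    then have zl: "(z \<longlongrightarrow> p0 c) (at s0)" by (simp add: LIM_zero_iff)
    \<comment> \<open>Convergence of jets is convergence in each coordinate: z is squeezed to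
      \<open>p0 c\<close>, and the others follow the curve or are constant.\<close>
    have ql: "((\<lambda>s. (q s)(c := z s)) \<longlongrightarrow> p0) (at s0)"
      unfolding tendsto_fun_iff
    proof
      fix d
      show "((\<lambda>s. ((q s)(c := z s)) d) \<longlongrightarrow> p0 d) (at s0)"
      proof (cases "d = c")
        case True then show ?thesis using zl by simp
      next
        case False
        then show ?thesis using gc[of d] insert.prems
          by (cases "d \<in> S'") (auto simp: q_def mix_def)
      qed
    qed
    have fl: "((\<lambda>s. pd c F ((q s)(c := z s))) \<longlongrightarrow> pd c F p0) (at s0)"
    proof -
      have "\<forall>\<^sub>F s in at s0. (q s)(c := z s) \<in> D"
        using gD' by eventually_elim (rule z(2))
      then show ?thesis by (rule continuous_on_tendsto_compose[OF F(2) ql p0])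
    qed
    have "((\<lambda>s. F (mix (insert c S') s) - F (mix S' s)) has_real_derivative pd c F p0 * g' c) (at s0)"
      unfolding has_field_derivative_iff
    proof (rule Lim_transform_eventually)
      show "((\<lambda>s. pd c F ((q s)(c := z s)) * ((g s c - g s0 c) / (s - s0))) \<longlongrightarrow> pd c F p0 * g' c) (at s0)"
        by (intro tendsto_mult fl g[OF cS(1), unfolded has_field_derivative_iff])
      show "\<forall>\<^sub>F s in at s0. pd c F ((q s)(c := z s)) * ((g s c - g s0 c) / (s - s0)) =
         (F (mix (insert c S') s) - F (mix S' s) - (F (mix (insert c S') s0) - F (mix S' s0))) / (s - s0)"
        using gD'
      proof eventually_elim
        case (elim s)
        have "F (mix (insert c S') s) - F (mix S' s) = (g s c - g s0 c) * pd c F ((q s)(c := z s))"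
          using z(3)[OF elim] by (simp add: mix_ins q_def p0_def)
        then show ?case by (simp add: mix0)
      qed
    qed
    from DERIV_add[OF this insert.IH] show ?case using insert by simp
  qed
  from this[OF S(1) subset_refl]
  have "((\<lambda>s. F (mix S s)) has_real_derivative (\<Sum>c\<in>S. pd c F p0 * g' c)) (at s0)" .
  moreover have ev: "\<forall>\<^sub>F s in nhds s0. F (mix S s) = F (g s)"
    using gD by eventually_elim (rule depD[OF S(2) mixD], auto simp: mix_def)
  ultimately show ?thesis using DERIV_cong_ev[OF refl ev refl] by (simp add: p0_def)
qed

subsection \<open>Smooth functions and primitives\<close>

definition smooth :: "(jpt \<Rightarrow> real) \<Rightarrow> bool" where
  "smooth F \<longleftrightarrow> (\<forall>n. smooth_upto n F)"

lemma smooth_cont: "smooth F \<Longrightarrow> continuous_on D F"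
  unfolding smooth_def using smooth_upto_cont by blast

lemma smooth_has_pd: "smooth F \<Longrightarrow> p \<in> D \<Longrightarrow> has_pd c F (pd c F p) p"
  unfolding smooth_def using smooth_upto.simps(2) by blast

lemma smooth_pd: "smooth F \<Longrightarrow> smooth (pd c F)"
  unfolding smooth_def using smooth_upto.simps(2) by blast

text \<open>Links \<open>smooth\<close> to the regularity clause of \<open>jet_fun\<close>. In the
  harder direction a coordinate appended to the list is the innermost derivative, so the clause for
  F contains the clause for \<open>pd c F\<close>.\<close>

lemma smooth_pds:
  "smooth F \<longleftrightarrow> (\<forall>cs. continuous_on D (pds cs F) \<and>
        (\<forall>p\<in>D. \<forall>c. (\<lambda>s. pds cs F (p(c := s))) differentiable (at (p c))))"
  (is "_ \<longleftrightarrow> ?R F")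
proof
  assume "smooth F"
  then have "smooth (pds cs F)" for cs by (induction cs) (auto intro: smooth_pd)
  then show "?R F"
    using smooth_cont smooth_has_pd unfolding has_pd_def
    by (meson real_differentiable_def)
next
  assume R: "?R F"
  have "smooth_upto n F" if "?R F" for n F
    using that
  proof (induction n arbitrary: F)
    case 0
    show ?case using 0[rule_format, of "[]"] by simp
  next
    case (Suc n)
    have "?R (pd c F)" for c
      using Suc.prems pds_append[of _ "[c]" F] by (metis pds.simps)
    moreover have "has_pd c F (pd c F p) p" if "p \<in> D" for c p
      using Suc.prems[rule_format, of "[]"] that has_pd_pd[of c F _ p]
      unfolding has_pd_def by (metis pds.simps(1) real_differentiable_def)
    ultimately show ?case using Suc.IH Suc.prems[rule_format, of "[]"] by simp
  qed
  then show "smooth F" using R by (auto simp: smooth_def)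
qed

lemma chain_curve':
  assumes "finite S" "dep S F" "smooth F"
    and "\<And>c. c \<in> S \<Longrightarrow> ((\<lambda>s. g s c) has_real_derivative g' c) (at s0)"
    and "\<forall>\<^sub>F s in nhds s0. g s \<in> D"
  shows "((\<lambda>s. F (g s)) has_real_derivative (\<Sum>c\<in>S. pd c F (g s0) * g' c)) (at s0)"
  by (rule chain_curve) (use assms smooth_has_pd smooth_pd smooth_cont in auto)

lemma has_pd_comp:
  assumes "finite S" "dep S F" "smooth F" "p \<in> D"
    and R: "\<And>p. p \<in> D \<Longrightarrow> R p \<in> D" "\<And>c. c \<in> S \<Longrightarrow> smooth (\<lambda>p. R p c)"
  shows "has_pd d (\<lambda>p. F (R p)) (\<Sum>c\<in>S. pd c F (R p) * pd d (\<lambda>p. R p c) p) p"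
proof -
  have ev: "\<forall>\<^sub>F s in nhds (p d). R (p(d := s)) \<in> D"
    using eventually_D[OF assms(4)] by eventually_elim (rule R)
  have "((\<lambda>s. R (p(d := s)) c) has_real_derivative pd d (\<lambda>p. R p c) p) (at (p d))" if "c \<in> S" for c
    using smooth_has_pd[OF R(2)[OF that] assms(4), of d] by (simp add: has_pd_def)
  then have "((\<lambda>s. F (R (p(d := s)))) has_real_derivative
      (\<Sum>c\<in>S. pd c F (R (p(d := p d))) * pd d (\<lambda>p. R p c) p)) (at (p d))"
    by (intro chain_curve'[where g="\<lambda>s. R (p(d := s))" and g'="\<lambda>c. pd d (\<lambda>p. R p c) p" and ?s0.0="p d"]
        assms(1-3) ev)
  then show ?thesis by (simp add: has_pd_def)
qed

text \<open>The induction runs over all outer functions F, since the derivative of the composite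
  again contains composites, with \<open>pd c F\<close> in place of F.\<close>

lemma smooth_upto_comp:
  assumes "finite S" "dep S F" "smooth F"
    and R: "\<And>p. p \<in> D \<Longrightarrow> R p \<in> D" "\<And>c. smooth (\<lambda>p. R p c)"
  shows "smooth_upto n (\<lambda>p. F (R p))"
  using assms(2,3)
proof (induction n arbitrary: F)
  case 0
  have "continuous_on D R"
    by (rule continuous_on_coordinatewise_then_product) (rule smooth_cont[OF R(2)])
  then show ?case
    using continuous_on_compose2[OF smooth_cont[OF 0(2)], of D R] R(1) by auto
next
  case (Suc n)
  have s0: "smooth_upto m (pd d (\<lambda>p. R p c))" for d c m using smooth_pd[OF R(2)] by (simp add: smooth_def)
  show ?case
  proof (rule smooth_upto_SucI)
    have "continuous_on D R"
      by (rule continuous_on_coordinatewise_then_product) (rule smooth_cont[OF R(2)])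
    then show "continuous_on D (\<lambda>p. F (R p))"
      using continuous_on_compose2[OF smooth_cont[OF Suc.prems(2)], of D R] R(1) by auto
  next
    fix p c assume "p \<in> D"
    then show "has_pd c (\<lambda>p. F (R p)) ((\<lambda>d p. \<Sum>c\<in>S. pd c F (R p) * pd d (\<lambda>p. R p c) p) c p) p"
      using has_pd_comp[OF assms(1) Suc.prems _ R] by simp
  next
    fix d
    show "smooth_upto n (\<lambda>p. \<Sum>c\<in>S. pd c F (R p) * pd d (\<lambda>p. R p c) p)"
      by (intro smooth_upto_sum assms(1) smooth_upto_mult s0 Suc.IH dep_pd smooth_pd Suc.prems)
  qed
qed

text \<open>The integral from a to the c-th coordinate, rescaled to the unit interval so that Leibniz' rule
  applies in the direction c as well.\<close>

definition prim :: "coord \<Rightarrow> real \<Rightarrow> (jpt \<Rightarrow> real) \<Rightarrow> jpt \<Rightarrow> real" where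
  "prim c a f p = integral (cbox 0 1) (\<lambda>\<tau>. (p c - a) * f (p(c := a + \<tau> * (p c - a))))"

lemma coord_range_seg: "a \<in> coord_range c \<Longrightarrow> x \<in> coord_range c \<Longrightarrow> \<tau> \<in> cbox 0 1 \<Longrightarrow> a + \<tau> * (x - a) \<in> coord_range c"
  using convexD_alt[OF coord_range(3), of a c x \<tau>] by (simp add: algebra_simps)

lemma seg_D: "p \<in> D \<Longrightarrow> a \<in> coord_range c \<Longrightarrow> \<tau> \<in> cbox 0 1 \<Longrightarrow> p(c := a + \<tau> * (p c - a)) \<in> D"
  using coord_range_seg coord_range(4,5) by simp

lemma cont_seg:
  fixes g :: "'a::topological_space \<Rightarrow> jpt" and h :: "'a \<Rightarrow> real"
  assumes "continuous_on D f" "continuous_on S g" "continuous_on S h"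
    and "\<And>x. x \<in> S \<Longrightarrow> (g x)(c := h x) \<in> D"
  shows "continuous_on S (\<lambda>x. f ((g x)(c := h x)))"
proof (rule continuous_on_compose2[OF assms(1)])
  show "continuous_on S (\<lambda>x. (g x)(c := h x))"
  proof (rule continuous_on_coordinatewise_then_product)
    fix i show "continuous_on S (\<lambda>x. ((g x)(c := h x)) i)"
      using assms(3) continuous_on_product_then_coordinatewise[OF assms(2)] by (cases "i = c") auto
  qed
qed (use assms(4) in auto)

lemma prim_cont:
  assumes f: "continuous_on D f" and a: "a \<in> coord_range c"
  shows "continuous_on D (prim c a f)"
proof -
  have c1: "continuous_on S (\<lambda>x. (fst x) c)" for S :: "(jpt \<times> real) set"
    by (rule continuous_on_product_then_coordinatewise) (intro continuous_intros)
  have "continuous_on (D \<times> cbox 0 1)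
     (\<lambda>x. (fst x c - a) * f ((fst x)(c := a + snd x * (fst x c - a))))"
    by (rule continuous_on_mult[OF _ cont_seg[OF f]])
       (intro continuous_intros c1 | use seg_D a in auto)+
  then have "continuous_on (D \<times> cbox 0 1) (\<lambda>(p, \<tau>). (p c - a) * f (p(c := a + \<tau> * (p c - a))))"
    by (simp add: case_prod_unfold)
  from integral_continuous_on_param[OF this] show ?thesis
    by (simp add: prim_def[abs_def])
qed

lemma cont_line:
  assumes f: "continuous_on D f" and p: "p \<in> D" and h: "continuous_on S h" "\<And>x. x \<in> S \<Longrightarrow> h x \<in> coord_range c"
  shows "continuous_on S (\<lambda>x. f (p(c := h x)))"
  by (rule cont_seg[OF f continuous_on_const h(1)]) (use p h in \<open>auto simp: coord_range\<close>)

lemma has_pd_line: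
  assumes "\<And>p. p \<in> D \<Longrightarrow> has_pd c f (pd c f p) p" "p \<in> D" "x \<in> coord_range c"
  shows "((\<lambda>s. f (p(c := s))) has_real_derivative pd c f (p(c := x))) (at x)"
  using assms(1)[of "p(c := x)"] assms(2,3) by (simp add: has_pd_def coord_range)

lemma has_pd_seg:
  assumes "\<And>p. p \<in> D \<Longrightarrow> has_pd c f (pd c f p) p" "p \<in> D" "h x \<in> coord_range c"
    "(h has_real_derivative h') (at x within S)"
  shows "((\<lambda>x. f (p(c := h x))) has_real_derivative pd c f (p(c := h x)) * h') (at x within S)"
  using DERIV_chain2[OF has_pd_line[OF assms(1-3)] assms(4)] by simp

lemma prim_pd_other:
  assumes f: "smooth_upto (Suc 0) f" and a: "a \<in> coord_range c" and p: "p \<in> D" and dc: "d \<noteq> c"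
  shows "has_pd d (prim c a f) (prim c a (pd d f) p) p"
proof -
  have fc: "continuous_on D f" "continuous_on D (pd d f)"
    and fd: "\<And>p. p \<in> D \<Longrightarrow> has_pd d f (pd d f p) p" using f by auto
  define G where "G = (\<lambda>g x \<tau>. (p c - a) * g ((p(d := x))(c := a + \<tau> * (p c - a))) :: real)"
  have sg: "p(c := a + \<tau> * (p c - a)) \<in> D" if "\<tau> \<in> cbox 0 1" for \<tau> using seg_D p a that by simp
  have cG: "continuous_on (coord_range d \<times> cbox 0 1) (\<lambda>(x, \<tau>). G g x \<tau>)" if "continuous_on D g" for g
  proof -
    have c1: "continuous_on (coord_range d \<times> cbox 0 1) (\<lambda>z. p(d := fst z))"
    proof (rule continuous_on_coordinatewise_then_product)
      fix i show "continuous_on (coord_range d \<times> cbox 0 1) (\<lambda>z. (p(d := fst z)) i)"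
        by (cases "i = d") (auto intro!: continuous_intros)
    qed
    have c2: "(p(d := x))(c := a + t * (p c - a)) \<in> D" if "x \<in> coord_range d" "t \<in> cbox 0 1" for x t
      using seg_D[of "p(d := x)" a c t] that p a dc by (simp add: coord_range)
    have c3: "continuous_on (coord_range d \<times> cbox 0 1) (\<lambda>z. a + snd z * (p c - a))"
      by (intro continuous_intros)
    have "continuous_on (coord_range d \<times> cbox 0 1) (\<lambda>z. G g (fst z) (snd z))"
      unfolding G_def
      by (rule continuous_on_mult[OF continuous_on_const cont_seg[OF that c1 c3]]) (auto intro: c2)
    then show ?thesis by (simp add: case_prod_unfold)
  qed
  have eq: "G g x = (\<lambda>\<tau>. ((p(d:=x)) c - a) * g ((p(d := x))(c := a + \<tau> * ((p(d:=x)) c - a))))" for g x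
    using dc by (simp add: G_def)
  have "((\<lambda>x. integral (cbox 0 1) (G f x)) has_field_derivative integral (cbox 0 1) (G (pd d f) (p d)))
      (at (p d) within coord_range d)"
  proof (rule leibniz_rule_field_derivative)
    fix x t assume x: "x \<in> coord_range d" and t: "t \<in> cbox (0::real) 1"
    have tw: "(p(d := y))(c := z) = (p(c := z))(d := y)" for y z using dc by (auto simp: fun_eq_iff)
    have "((\<lambda>x. f ((p(c := a + t * (p c - a)))(d := x))) has_real_derivative
        pd d f ((p(c := a + t * (p c - a)))(d := x))) (at x)"
      by (rule has_pd_line[OF fd sg[OF t] x])
    then show "((\<lambda>x. G f x t) has_field_derivative G (pd d f) x t) (at x within coord_range d)"
      unfolding G_def tw by (rule DERIV_cmult[OF has_field_derivative_at_within])
  next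
    fix x assume x: "x \<in> coord_range d"
    have "continuous_on (cbox 0 1) (\<lambda>\<tau>. (\<lambda>(x, \<tau>). G f x \<tau>) (x, \<tau>))"
      by (rule continuous_on_compose2[OF cG[OF fc(1)]]) (use x in \<open>auto intro!: continuous_intros\<close>)
    then show "G f x integrable_on cbox 0 1"
      by (intro integrable_continuous) simp
  qed (use cG[OF fc(2)] coord_range p in auto)
  then have "((\<lambda>x. integral (cbox 0 1) (G f x)) has_field_derivative integral (cbox 0 1) (G (pd d f) (p d)))
      (at (p d))"
    using at_within_open[OF coord_range(4)[OF p] coord_range(1)] by metis
  then show ?thesis unfolding has_pd_def prim_def eq by simp
qed

lemma prim_pd_same:
  assumes f: "smooth_upto (Suc 0) f" and a: "a \<in> coord_range c" and p: "p \<in> D"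
  shows "has_pd c (prim c a f) (f p) p"
proof -
  have fc: "continuous_on D f" "continuous_on D (pd c f)"
    and fd: "\<And>p. p \<in> D \<Longrightarrow> has_pd c f (pd c f p) p" using f by auto
  define G where "G = (\<lambda>x \<tau>. (x - a) * f (p(c := a + \<tau> * (x - a))))"
  define G' where "G' = (\<lambda>x \<tau>. f (p(c := a + \<tau> * (x - a))) + (x - a) * (pd c f (p(c := a + \<tau> * (x - a))) * \<tau>))"
  have cg: "continuous_on (coord_range c \<times> cbox 0 1) (\<lambda>z. g (p(c := a + snd z * (fst z - a))))"
    if "continuous_on D g" for g
    by (rule cont_line[OF that p]) (auto intro!: continuous_intros coord_range_seg a)
  have cG: "continuous_on (coord_range c \<times> cbox 0 1) (\<lambda>(x, \<tau>). G x \<tau>)"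
    unfolding case_prod_unfold G_def
    by (intro continuous_intros cg[OF fc(1)])
  have cG': "continuous_on (coord_range c \<times> cbox 0 1) (\<lambda>(x, \<tau>). G' x \<tau>)"
    unfolding case_prod_unfold G'_def
    by (intro continuous_intros cg[OF fc(1)] cg[OF fc(2)])
  have "((\<lambda>x. integral (cbox 0 1) (G x)) has_field_derivative integral (cbox 0 1) (G' (p c)))
      (at (p c) within coord_range c)"
  proof (rule leibniz_rule_field_derivative)
    fix x t assume x: "x \<in> coord_range c" and t: "t \<in> cbox (0::real) 1"
    have "((\<lambda>x. a + t * (x - a)) has_real_derivative t) (at x within coord_range c)"
      by (auto intro!: derivative_eq_intros)
    from has_pd_seg[OF fd p coord_range_seg[OF a x t] this]
    have "((\<lambda>x. f (p(c := a + t * (x - a)))) has_real_derivative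
        pd c f (p(c := a + t * (x - a))) * t) (at x within coord_range c)" .
    from DERIV_mult[OF DERIV_diff[OF DERIV_ident DERIV_const[of a]] this]
    show "((\<lambda>x. G x t) has_field_derivative G' x t) (at x within coord_range c)"
      unfolding G_def G'_def by (simp add: algebra_simps)
  next
    fix x assume x: "x \<in> coord_range c"
    have "continuous_on (cbox 0 1) (\<lambda>\<tau>. (\<lambda>(x, \<tau>). G x \<tau>) (x, \<tau>))"
      by (rule continuous_on_compose2[OF cG]) (use x in \<open>auto intro!: continuous_intros\<close>)
    then show "G x integrable_on cbox 0 1"
      by (intro integrable_continuous) simp
  qed (use cG' coord_range p in auto)
  then have *: "((\<lambda>x. integral (cbox 0 1) (G x)) has_field_derivative integral (cbox 0 1) (G' (p c))) (at (p c))"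
    using at_within_open[OF coord_range(4)[OF p] coord_range(1)] by metis
  \<comment> \<open>The integrand is the \<tau>-derivative of \<tau> f taken at the point a + \<tau>
    (x - a) of the segment, so its integral is the value at \<tau> = 1, which is f p.\<close>
  have "(G' (p c) has_integral (1 * f (p(c := a + 1 * (p c - a))) - 0 * f (p(c := a + 0 * (p c - a))))) {0..1}"
  proof (rule fundamental_theorem_of_calculus)
    fix t assume "t \<in> {0..1::real}"
    then have t: "t \<in> cbox 0 1" by simp
    have "((\<lambda>t. a + t * (p c - a)) has_real_derivative (p c - a)) (at t within {0..1})"
      by (auto intro!: derivative_eq_intros)
    from has_pd_seg[OF fd p coord_range_seg[OF a coord_range(4)[OF p] t] this]
    have "((\<lambda>x. f (p(c := a + x * (p c - a)))) has_real_derivative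
        pd c f (p(c := a + t * (p c - a))) * (p c - a)) (at t within {0..1})" .
    from DERIV_mult[OF DERIV_ident this]
    show "((\<lambda>t. t * f (p(c := a + t * (p c - a)))) has_vector_derivative G' (p c) t) (at t within {0..1})"
      unfolding G'_def has_real_derivative_iff_has_vector_derivative[symmetric] by (simp add: algebra_simps)
  qed simp
  then have "integral (cbox 0 1) (G' (p c)) = f p" by (simp add: integral_unique)
  then show ?thesis using * by (simp add: has_pd_def prim_def G_def)
qed

lemma prim_pd_self:
  assumes f: "\<And>p. p \<in> D \<Longrightarrow> has_pd c f (pd c f p) p" and a: "a \<in> coord_range c" and p: "p \<in> D"
  shows "prim c a (pd c f) p = f p - f (p(c := a))"
proof -
  have "((\<lambda>t. (p c - a) * pd c f (p(c := a + t * (p c - a)))) has_integral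
     (f (p(c := a + 1 * (p c - a))) - f (p(c := a + 0 * (p c - a))))) {0..1}"
  proof (rule fundamental_theorem_of_calculus)
    fix t assume "t \<in> {0..1::real}"
    then have t: "t \<in> cbox 0 1" by simp
    have "((\<lambda>t. a + t * (p c - a)) has_real_derivative (p c - a)) (at t within {0..1})"
      by (auto intro!: derivative_eq_intros)
    from has_pd_seg[OF f p coord_range_seg[OF a coord_range(4)[OF p] t] this]
    show "((\<lambda>t. f (p(c := a + t * (p c - a)))) has_vector_derivative
       (p c - a) * pd c f (p(c := a + t * (p c - a)))) (at t within {0..1})"
      unfolding has_real_derivative_iff_has_vector_derivative[symmetric] by (simp add: mult.commute)
  qed simp
  then show ?thesis unfolding prim_def cbox_interval by (subst integral_unique) auto
qed

text \<open>Differentiating a primitive gives f itself in the direction c and the primitive of a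
  derivative of f in every other direction, so the induction closes.\<close>

lemma smooth_upto_prim: "smooth_upto n f \<Longrightarrow> a \<in> coord_range c \<Longrightarrow> smooth_upto n (prim c a f)"
proof (induction n arbitrary: f)
  case 0
  then show ?case by (simp add: prim_cont)
next
  case (Suc n)
  have f1: "smooth_upto (Suc 0) f" using Suc.prems by (auto intro: smooth_upto_cont)
  show ?case
  proof (rule smooth_upto_SucI)
    show "continuous_on D (prim c a f)" using Suc.prems by (simp add: prim_cont)
    show "has_pd d (prim c a f) ((\<lambda>d. if d = c then f else prim c a (pd d f)) d p) p" if "p \<in> D" for p d
      using prim_pd_other[OF f1 Suc.prems(2) that, of d] prim_pd_same[OF f1 Suc.prems(2) that] by auto
    show "smooth_upto n (if d = c then f else prim c a (pd d f))" for d
      using Suc smooth_upto_Suc[of n f] by auto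
  qed
qed

text \<open>Differentiate the identity expressing F through the primitive of its c-derivative under the integral.\<close>

lemma pd_commute:
  assumes F: "smooth F" and p: "p \<in> D"
  shows "pd c (pd d F) p = pd d (pd c F) p"
proof (cases "c = d")
  case False
  define a where "a = p c"
  have a: "a \<in> coord_range c" using coord_range(4)[OF p] by (simp add: a_def)
  define G where "G = (\<lambda>q. pd d F (q(c := a)))"
  have hF: "\<And>p c. p \<in> D \<Longrightarrow> has_pd c F (pd c F p) p" using smooth_has_pd[OF F] .
  have sF: "smooth_upto n (pd c (pd d F))" "smooth_upto n (pd c F)" for n c d
    using smooth_pd F by (auto simp: smooth_def)
  have eq: "prim c a (pd d (pd c F)) q + G q = pd d F q" if q: "q \<in> D" for q
  proof -
    have qa: "q(c := a) \<in> D" using q a coord_range by simp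
    have "has_pd d (\<lambda>q. F (q(c := a))) (G q) q"
      using hF[OF qa, of d] False by (simp add: has_pd_def G_def fun_upd_twist)
    with prim_pd_other[OF sF(2) a q, of d] False
    have "has_pd d (\<lambda>q. prim c a (pd c F) q + F (q(c := a))) (prim c a (pd d (pd c F)) q + G q) q"
      by (intro has_pd_add) auto
    from has_pd_cong[OF this _ q, of F] show ?thesis
      using prim_pd_self[OF hF a] has_pd_pd by fastforce
  qed
  have "has_pd c G 0 p" by (simp add: has_pd_def G_def)
  from has_pd_add[OF prim_pd_same[OF sF(1) a p] this]
  have "has_pd c (\<lambda>q. prim c a (pd d (pd c F)) q + G q) (pd d (pd c F) p) p" by simp
  from has_pd_cong[OF this eq p] show ?thesis by (simp add: has_pd_pd)
qed simp

subsection \<open>Derivations\<close>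

text \<open>The support is an explicit argument because the order in u is read off from it and sums
  over coordinates run over it.\<close>

definition jet_on :: "coord set \<Rightarrow> (jpt \<Rightarrow> real) \<Rightarrow> bool" where
  "jet_on S F \<longleftrightarrow> finite S \<and> dep S F \<and> smooth F"

lemma jfD: "jet_on S F \<Longrightarrow> finite S" "jet_on S F \<Longrightarrow> dep S F" "jet_on S F \<Longrightarrow> smooth F"
  by (auto simp: jet_on_def)

lemma jet_on_mono: "jet_on S F \<Longrightarrow> S \<subseteq> S' \<Longrightarrow> finite S' \<Longrightarrow> jet_on S' F"
  by (auto simp: jet_on_def intro: dep_mono)

lemma jet_on_cong:
  assumes "jet_on S F" "\<And>p. p \<in> D \<Longrightarrow> F p = G p" shows "jet_on S G"
proof -
  have "smooth_upto n G" for n by (rule smooth_upto_cong[OF assms(2)]) (use assms in \<open>auto simp: jet_on_def smooth_def\<close>)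
  moreover have "dep S G"
    unfolding dep_def using depD[OF jfD(2)[OF assms(1)]] assms(2) by (metis (no_types, lifting))
  ultimately show ?thesis using jfD(1)[OF assms(1)] by (simp add: jet_on_def smooth_def)
qed

lemma jet_on_const: "finite S \<Longrightarrow> jet_on S (\<lambda>p. a)"
  by (auto simp: jet_on_def dep_def smooth_def smooth_upto_const)

lemma jet_on_coord: "finite S \<Longrightarrow> c \<in> S \<Longrightarrow> jet_on S (\<lambda>p. p c)"
  by (auto simp: jet_on_def dep_def smooth_def smooth_upto_coord)

lemma dep_lift2:
  "dep S F \<Longrightarrow> dep S G \<Longrightarrow> dep S (\<lambda>p. h (F p) (G p))"
  unfolding dep_def by (metis (no_types, lifting))

lemma jet_on_add: "jet_on S F \<Longrightarrow> jet_on S G \<Longrightarrow> jet_on S (\<lambda>p. F p + G p)"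
  by (simp add: jet_on_def smooth_def smooth_upto_add dep_lift2[where h="(+)"])

lemma jet_on_mult: "jet_on S F \<Longrightarrow> jet_on S G \<Longrightarrow> jet_on S (\<lambda>p. F p * G p)"
  by (simp add: jet_on_def smooth_def smooth_upto_mult dep_lift2[where h="(*)"])

lemma jet_on_minus: "jet_on S F \<Longrightarrow> jet_on S (\<lambda>p. - F p)"
  using jet_on_mult[where G=F, OF jet_on_const[where a="-1"]] by (simp add: jfD(1))

lemma jet_on_diff: assumes "jet_on S F" "jet_on S G" shows "jet_on S (\<lambda>p. F p - G p)"
  using jet_on_add[OF assms(1) jet_on_minus[OF assms(2)]] by simp

lemma jet_on_sum:
  assumes "finite K" "finite S" "\<And>c. c \<in> K \<Longrightarrow> jet_on S (F c)"
  shows "jet_on S (\<lambda>p. \<Sum>c\<in>K. F c p)"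
  using assms(1,3)
proof (induction K rule: finite_induct)
  case empty
  then show ?case using jet_on_const[OF assms(2), of 0] by simp
next
  case (insert c K)
  then show ?case using jet_on_add[of S "F c" "\<lambda>p. \<Sum>c\<in>K. F c p"] by simp
qed

lemma jet_on_pd: "jet_on S F \<Longrightarrow> jet_on S (pd c F)"
  by (auto simp: jet_on_def smooth_pd dep_pd)

lemma jet_on_prim: assumes "jet_on S f" "a \<in> coord_range c" "c \<in> S" shows "jet_on S (prim c a f)"
proof -
  have "dep S (prim c a f)" unfolding dep_def
  proof (intro ballI impI)
    fix p q assume pq: "p \<in> D" "q \<in> D" "\<forall>c\<in>S. p c = q c"
    have c: "p c = q c" using pq assms by auto
    have "f (p(c := a + \<tau> * (q c - a))) = f (q(c := a + \<tau> * (q c - a)))" if "\<tau> \<in> cbox 0 1" for \<tau>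
      using depD[OF jfD(2)[OF assms(1)] seg_D[OF pq(1) assms(2) that] seg_D[OF pq(2) assms(2) that]] pq(3) c
      by auto
    then show "prim c a f p = prim c a f q" unfolding prim_def c by (intro integral_cong) simp
  qed
  then show ?thesis using assms by (simp add: jet_on_def smooth_def smooth_upto_prim)
qed

lemma pd_add: "smooth F \<Longrightarrow> smooth G \<Longrightarrow> p \<in> D \<Longrightarrow> pd c (\<lambda>p. F p + G p) p = pd c F p + pd c G p"
  by (rule has_pd_pd[OF has_pd_add]) (auto intro: smooth_has_pd)

lemma pd_mult:
  "smooth F \<Longrightarrow> smooth G \<Longrightarrow> p \<in> D \<Longrightarrow> pd c (\<lambda>p. F p * G p) p = pd c F p * G p + F p * pd c G p"
  by (rule has_pd_pd[OF has_pd_mult]) (auto intro: smooth_has_pd)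

lemma pd_const: "pd c (\<lambda>p. a) p = 0"
  by (rule has_pd_pd[OF has_pd_const])

lemma pd_coord: "pd c (\<lambda>p. p d) p = (if c = d then 1 else 0)"
  by (rule has_pd_pd[OF has_pd_coord])

lemma pd_outside: "jet_on S F \<Longrightarrow> c \<notin> S \<Longrightarrow> p \<in> D \<Longrightarrow> pd c F p = 0"
  by (rule has_pd_pd[OF dep_pd_0]) (auto simp: jet_on_def)

lemma pd_prim_same: "jet_on S f \<Longrightarrow> a \<in> coord_range c \<Longrightarrow> p \<in> D \<Longrightarrow> pd c (prim c a f) p = f p"
  by (rule has_pd_pd[OF prim_pd_same]) (auto simp: jet_on_def smooth_def)

lemma pd_prim_other:
  "jet_on S f \<Longrightarrow> a \<in> coord_range c \<Longrightarrow> p \<in> D \<Longrightarrow> d \<noteq> c \<Longrightarrow> pd d (prim c a f) p = prim c a (pd d f) p"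
  by (rule has_pd_pd[OF prim_pd_other]) (auto simp: jet_on_def smooth_def)

text \<open>Two values of the coordinate c are joined inside its range, which is an interval, so the
  mean value theorem makes F constant along c. All reductions of order end in this lemma.\<close>

lemma dep_remove:
  assumes F: "jet_on S F" and 0: "\<And>p. p \<in> D \<Longrightarrow> pd c F p = 0"
  shows "jet_on (S - {c}) F"
proof -
  have "F p = F q" if pq: "p \<in> D" "q \<in> D" "\<forall>d\<in>S - {c}. p d = q d" for p q
  proof -
    have m: "p(c := q c) \<in> D" using pq by (simp add: coord_range)
    have "F (p(c := q c)) = F p"
      using pd_mvt[OF smooth_has_pd[OF jfD(3)[OF F]] pq(1) m] 0 by auto
    moreover have "F (p(c := q c)) = F q"
      by (rule depD[OF jfD(2)[OF F] m pq(2)]) (use pq(3) in auto)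
    ultimately show ?thesis by simp
  qed
  then have "dep (S - {c}) F" unfolding dep_def by blast
  then show ?thesis using F by (simp add: jet_on_def)
qed

section \<open>Product rule, chain rule and commutation for derivations\<close>

lemma der_expand:
  assumes "jet_on S F" "S \<subseteq> S'" "finite S'" "p \<in> D"
  shows "der \<xi> F p = (\<Sum>c\<in>S'. \<xi> c p * pd c F p)"
proof -
  have "pd c F p = 0" if "c \<notin> S" for c by (rule pd_outside[OF assms(1) that assms(4)])
  then show ?thesis unfolding der_def by (intro sum.mono_neutral_left) (use assms in auto)
qed

lemma der_cong: "(\<And>p. p \<in> D \<Longrightarrow> F p = G p) \<Longrightarrow> p \<in> D \<Longrightarrow> der \<xi> F p = der \<xi> G p"
  using pd_cong[of F G p] by (simp add: der_def)

lemma der_add: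
  assumes "jet_on S F" "jet_on S G" "p \<in> D"
  shows "der \<xi> (\<lambda>p. F p + G p) p = der \<xi> F p + der \<xi> G p"
proof -
  note e = der_expand[OF _ subset_refl jfD(1)[OF assms(1)] assms(3), of _ \<xi>]
  show ?thesis
    unfolding e[OF assms(1)] e[OF assms(2)] e[OF jet_on_add[OF assms(1,2)]] sum.distrib[symmetric]
    by (rule sum.cong) (simp_all add: pd_add jfD(3)[OF assms(1)] jfD(3)[OF assms(2)] assms(3) distrib_left)
qed

lemma der_mult:
  assumes "jet_on S F" "jet_on S G" "p \<in> D"
  shows "der \<xi> (\<lambda>p. F p * G p) p = der \<xi> F p * G p + F p * der \<xi> G p"
proof -
  note e = der_expand[OF _ subset_refl jfD(1)[OF assms(1)] assms(3), of _ \<xi>]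
  show ?thesis
    unfolding e[OF assms(1)] e[OF assms(2)] e[OF jet_on_mult[OF assms(1,2)]]
      sum_distrib_left sum_distrib_right sum.distrib[symmetric]
    by (rule sum.cong)
       (simp_all add: pd_mult jfD(3)[OF assms(1)] jfD(3)[OF assms(2)] assms(3) algebra_simps)
qed

lemma der_const: "der \<xi> (\<lambda>p. a) p = 0"
  by (simp add: der_def pd_const)

lemma der_coord: "der \<xi> (\<lambda>p. p c) p = \<xi> c p"
proof -
  have "{d. pd d (\<lambda>p. p c) p \<noteq> 0} = {c}" by (auto simp: pd_coord)
  then show ?thesis by (simp add: der_def pd_coord)
qed

lemma der_minus: assumes "jet_on S F" "p \<in> D" shows "der \<xi> (\<lambda>p. - F p) p = - der \<xi> F p"
  using der_mult[OF jet_on_const[where a="-1", OF jfD(1)[OF assms(1)]] assms, of \<xi>] by (simp add: der_const)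

lemma der_diff:
  assumes "jet_on S F" "jet_on S G" "p \<in> D"
  shows "der \<xi> (\<lambda>p. F p - G p) p = der \<xi> F p - der \<xi> G p"
  using der_add[OF assms(1) jet_on_minus[OF assms(2)] assms(3), of \<xi>] der_minus[OF assms(2,3), of \<xi>] by simp

lemma der_fun:
  assumes "(g has_real_derivative g') (at (p c))"
  shows "der \<xi> (\<lambda>p. g (p c)) p = g' * \<xi> c p"
proof -
  have pd: "pd d (\<lambda>p. g (p c)) p = (if d = c then g' else 0)" for d
    by (rule has_pd_pd[OF has_pd_fun[where g=g and d=c and p=p and g'=g' and c=d, OF assms]])
  then have "{d. pd d (\<lambda>p. g (p c)) p \<noteq> 0} = (if g' = 0 then {} else {c})" by auto
  then show ?thesis by (auto simp: der_def pd)
qed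

lemma der_sum:
  assumes "finite K" "finite S" "\<And>c. c \<in> K \<Longrightarrow> jet_on S (F c)" "p \<in> D"
  shows "der \<xi> (\<lambda>p. \<Sum>c\<in>K. F c p) p = (\<Sum>c\<in>K. der \<xi> (F c) p)"
  using assms(1,3)
proof (induction K rule: finite_induct)
  case (insert c K)
  then show ?case
    using der_add[of S "F c" "\<lambda>p. \<Sum>c\<in>K. F c p" p \<xi>] jet_on_sum[of K S F] assms by simp
qed (simp add: der_const)

lemma jet_on_der:
  assumes "jet_on S F" "\<And>c. c \<in> S \<Longrightarrow> jet_on S' (\<xi> c)" "S \<subseteq> S'" "finite S'"
  shows "jet_on S' (der \<xi> F)"
proof (rule jet_on_cong)
  show "jet_on S' (\<lambda>p. \<Sum>c\<in>S. \<xi> c p * pd c F p)"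
    using assms jet_on_mono[OF jet_on_pd[OF assms(1)] assms(3,4)]
    by (intro jet_on_sum jet_on_mult) (auto dest: jfD(1))
  show "(\<Sum>c\<in>S. \<xi> c p * pd c F p) = der \<xi> F p" if "p \<in> D" for p
    by (rule der_expand[OF assms(1) subset_refl jfD(1)[OF assms(1)] that, symmetric])
qed

lemma dep_comp:
  assumes "dep S F" "\<And>p. p \<in> D \<Longrightarrow> R p \<in> D" "\<And>c. c \<in> S \<Longrightarrow> dep S' (\<lambda>p. R p c)"
  shows "dep S' (\<lambda>p. F (R p))"
  unfolding dep_def
proof (intro ballI impI)
  fix p q assume pq: "p \<in> D" "q \<in> D" "\<forall>c\<in>S'. p c = q c"
  show "F (R p) = F (R q)"
    by (rule depD[OF assms(1) assms(2)[OF pq(1)] assms(2)[OF pq(2)]])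
       (rule depD[OF assms(3)], use pq in auto)
qed

lemma jet_on_comp:
  assumes "jet_on S F" and R: "\<And>p. p \<in> D \<Longrightarrow> R p \<in> D" "\<And>c. smooth (\<lambda>p. R p c)"
    "\<And>c. c \<in> S \<Longrightarrow> jet_on S' (\<lambda>p. R p c)" and "finite S'"
  shows "jet_on S' (\<lambda>p. F (R p))"
proof -
  have "smooth (\<lambda>p. F (R p))"
    unfolding smooth_def by (intro allI smooth_upto_comp[OF jfD(1-3)[OF assms(1)] R(1,2)])
  moreover have "dep S' (\<lambda>p. F (R p))"
    by (rule dep_comp[OF jfD(2)[OF assms(1)]]) (auto intro: R(1) jfD(2)[OF R(3)])
  ultimately show ?thesis using assms(5) by (simp add: jet_on_def)
qed

lemma der_comp:
  assumes F: "jet_on S F" and R: "\<And>p. p \<in> D \<Longrightarrow> R p \<in> D" "\<And>c. smooth (\<lambda>p. R p c)"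
    "\<And>c. c \<in> S \<Longrightarrow> jet_on S' (\<lambda>p. R p c)" and "finite S'" and p: "p \<in> D"
  shows "der \<xi> (\<lambda>p. F (R p)) p = (\<Sum>c\<in>S. pd c F (R p) * der \<xi> (\<lambda>p. R p c) p)"
proof -
  have "der \<xi> (\<lambda>p. F (R p)) p = (\<Sum>d\<in>S'. \<xi> d p * pd d (\<lambda>p. F (R p)) p)"
    by (rule der_expand[OF jet_on_comp[OF F R assms(5)] subset_refl assms(5) p])
  also have "\<dots> = (\<Sum>d\<in>S'. \<xi> d p * (\<Sum>c\<in>S. pd c F (R p) * pd d (\<lambda>p. R p c) p))"
    using has_pd_pd[OF has_pd_comp[OF jfD(1-3)[OF F] p R(1,2)]] by simp
  also have "\<dots> = (\<Sum>c\<in>S. \<Sum>d\<in>S'. \<xi> d p * (pd c F (R p) * pd d (\<lambda>p. R p c) p))"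
    unfolding sum_distrib_left by (rule sum.swap)
  also have "\<dots> = (\<Sum>c\<in>S. pd c F (R p) * der \<xi> (\<lambda>p. R p c) p)"
  proof (rule sum.cong)
    fix c assume "c \<in> S"
    from der_expand[OF R(3)[OF this] subset_refl assms(5) p, of \<xi>]
    show "(\<Sum>d\<in>S'. \<xi> d p * (pd c F (R p) * pd d (\<lambda>p. R p c) p)) = pd c F (R p) * der \<xi> (\<lambda>p. R p c) p"
      by (simp add: sum_distrib_left mult_ac)
  qed simp
  finally show ?thesis .
qed

text \<open>Isolates the second-order part of the composite, which is symmetric in the two fields
  because mixed partial derivatives agree.\<close>

lemma der_der:
  assumes F: "jet_on S F" and xi: "\<And>c. c \<in> S \<Longrightarrow> jet_on S' (\<eta> c)"
    and S': "S \<subseteq> S'" "finite S'" and p: "p \<in> D"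
  shows "der \<xi> (der \<eta> F) p = (\<Sum>c\<in>S. der \<xi> (\<eta> c) p * pd c F p) +
     (\<Sum>c\<in>S. \<Sum>d\<in>S. \<eta> c p * (\<xi> d p * pd d (pd c F) p))"
proof -
  have fS: "finite S" using F by (rule jfD)
  have pdS: "jet_on S' (pd c F)" for c by (rule jet_on_mono[OF jet_on_pd[OF F] S'])
  have "der \<xi> (der \<eta> F) p = der \<xi> (\<lambda>p. \<Sum>c\<in>S. \<eta> c p * pd c F p) p"
    using der_expand[OF F subset_refl fS] by (intro der_cong p) auto
  also have "\<dots> = (\<Sum>c\<in>S. der \<xi> (\<lambda>p. \<eta> c p * pd c F p) p)"
    by (rule der_sum[OF fS S'(2) jet_on_mult[OF xi pdS] p])
  also have "\<dots> = (\<Sum>c\<in>S. der \<xi> (\<eta> c) p * pd c F p + \<eta> c p * der \<xi> (pd c F) p)"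
    using der_mult[OF xi pdS p] by (intro sum.cong) auto
  finally show ?thesis
    using der_expand[OF jet_on_pd[OF F] subset_refl fS p, of \<xi>] by (simp add: sum.distrib sum_distrib_left)
qed

text \<open>The second-order parts cancel by symmetry, so only the coefficients have to be compared:
  two derivations commute on F once they commute on the coordinates in its support.\<close>

lemma der_commute:
  assumes F: "jet_on S F" and xi: "\<And>c. c \<in> S \<Longrightarrow> jet_on S' (\<xi> c)" "\<And>c. c \<in> S \<Longrightarrow> jet_on S' (\<eta> c)"
    and S': "S \<subseteq> S'" "finite S'" and p: "p \<in> D"
    and eq: "\<And>c. c \<in> S \<Longrightarrow> der \<xi> (\<eta> c) p = der \<eta> (\<xi> c) p"
  shows "der \<xi> (der \<eta> F) p = der \<eta> (der \<xi> F) p"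
proof -
  have "(\<Sum>c\<in>S. \<Sum>d\<in>S. \<eta> c p * (\<xi> d p * pd d (pd c F) p)) =
    (\<Sum>d\<in>S. \<Sum>c\<in>S. \<eta> c p * (\<xi> d p * pd d (pd c F) p))"
    by (rule sum.swap)
  also have "\<dots> = (\<Sum>d\<in>S. \<Sum>c\<in>S. \<xi> d p * (\<eta> c p * pd c (pd d F) p))"
    using pd_commute[OF jfD(3)[OF F] p] by (simp add: mult_ac)
  finally have "(\<Sum>c\<in>S. \<Sum>d\<in>S. \<eta> c p * (\<xi> d p * pd d (pd c F) p)) =
    (\<Sum>d\<in>S. \<Sum>c\<in>S. \<xi> d p * (\<eta> c p * pd c (pd d F) p))" .
  moreover have "der \<xi> (der \<eta> F) p = (\<Sum>c\<in>S. der \<xi> (\<eta> c) p * pd c F p) +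
     (\<Sum>c\<in>S. \<Sum>d\<in>S. \<eta> c p * (\<xi> d p * pd d (pd c F) p))"
    by (rule der_der[OF F _ S' p]) (rule xi(2))
  moreover have "der \<eta> (der \<xi> F) p = (\<Sum>c\<in>S. der \<eta> (\<xi> c) p * pd c F p) +
     (\<Sum>c\<in>S. \<Sum>d\<in>S. \<xi> c p * (\<eta> d p * pd d (pd c F) p))"
    by (rule der_der[OF F _ S' p]) (rule xi(1))
  moreover have "(\<Sum>c\<in>S. der \<xi> (\<eta> c) p * pd c F p) = (\<Sum>c\<in>S. der \<eta> (\<xi> c) p * pd c F p)"
    by (rule sum.cong) (simp_all add: eq)
  ultimately show ?thesis by simp
qed

section \<open>Total derivatives on the full jet space\<close>

lemma full_der:
  assumes "jet_on S F" "p \<in> D"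
  shows "Dt F p = der full_t F p" "Dx F p = der full_x F p"
proof -
  have S: "finite S" using assms(1) by (rule jfD)
  let ?N = "{c. pd c F p \<noteq> 0}"
  have fin: "finite ?N"
    by (rule finite_subset[OF _ S]) (use pd_outside[OF assms(1)] assms(2) in auto)
  have N: "?N = {c. isJ c \<and> pd c F p \<noteq> 0} \<union> (?N \<inter> {T, X})"
  proof -
    have "isJ c \<or> c \<in> {T, X}" for c by (cases c) auto
    then show ?thesis by auto
  qed
  have *: "der \<xi> F p = (\<Sum>c\<in>{c. isJ c \<and> pd c F p \<noteq> 0}. \<xi> c p * pd c F p) + \<xi> T p * pd T F p + \<xi> X p * pd X F p" for \<xi>
  proof -
    have "der \<xi> F p = (\<Sum>c\<in>{c. isJ c \<and> pd c F p \<noteq> 0} \<union> (?N \<inter> {T, X}). \<xi> c p * pd c F p)"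
      unfolding der_def using N by simp
    also have "\<dots> = (\<Sum>c\<in>{c. isJ c \<and> pd c F p \<noteq> 0}. \<xi> c p * pd c F p) + (\<Sum>c\<in>?N \<inter> {T, X}. \<xi> c p * pd c F p)"
      by (rule sum.union_disjoint) (use fin in \<open>auto intro: finite_subset\<close>)
    also have "(\<Sum>c\<in>?N \<inter> {T, X}. \<xi> c p * pd c F p) = (\<Sum>c\<in>{T, X}. \<xi> c p * pd c F p)"
      by (rule sum.mono_neutral_left) auto
    finally show ?thesis by simp
  qed
  have "(\<Sum>c\<in>{c. isJ c \<and> pd c F p \<noteq> 0}. full_t c p * pd c F p) =
    (\<Sum>c\<in>{c. isJ c \<and> pd c F p \<noteq> 0}. p (tsh c) * pd c F p)"
    by (rule sum.cong) (auto simp: full_t_def split: coord.split)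
  then show "Dt F p = der full_t F p" using *[of full_t] by (simp add: Dt_def full_t_def)
  have "(\<Sum>c\<in>{c. isJ c \<and> pd c F p \<noteq> 0}. full_x c p * pd c F p) =
    (\<Sum>c\<in>{c. isJ c \<and> pd c F p \<noteq> 0}. p (xsh c) * pd c F p)"
    by (rule sum.cong) (auto simp: full_x_def split: coord.split)
  then show "Dx F p = der full_x F p" using *[of full_x] by (simp add: Dx_def full_x_def)
qed

text \<open>Here P may be infinite: this form is for classes closed under shifts of the indices,
  where the finite support itself is irrelevant.\<close>

definition supported :: "coord set \<Rightarrow> (jpt \<Rightarrow> real) \<Rightarrow> bool" where
  "supported P F \<longleftrightarrow> (\<exists>S. jet_on S F \<and> S \<subseteq> P)"

lemma supported_mono: "supported P F \<Longrightarrow> P \<subseteq> Q \<Longrightarrow> supported Q F"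
  unfolding supported_def by blast

lemma jet_on_supported: "jet_on S F \<Longrightarrow> S \<subseteq> P \<Longrightarrow> supported P F"
  unfolding supported_def by blast

lemma supported_eq:
  assumes "supported P F" "p \<in> D" "q \<in> D" "\<And>c. c \<in> P \<Longrightarrow> p c = q c"
  shows "F p = F q"
  using assms(1) depD[OF jfD(2) assms(2,3)] assms(4) unfolding supported_def by blast

lemma jet_fun_iff: "jet_fun m D F \<longleftrightarrow> supported {c. valid_coord m c} F"
  unfolding jet_fun_def supported_def jet_on_def dep_def smooth_pds by blast

lemma Dx_cong: "(\<And>p. p \<in> D \<Longrightarrow> F p = G p) \<Longrightarrow> p \<in> D \<Longrightarrow> Dx F p = Dx G p"
  using pd_cong[of F G p] by (simp add: Dx_def)

lemma Dt_cong: "(\<And>p. p \<in> D \<Longrightarrow> F p = G p) \<Longrightarrow> p \<in> D \<Longrightarrow> Dt F p = Dt G p"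
  using pd_cong[of F G p] by (simp add: Dt_def)

lemma jet_on_full:
  assumes "jet_on S F"
  shows "jet_on (S \<union> tsh ` S) (Dt F)" "jet_on (S \<union> xsh ` S) (Dx F)"
proof -
  have S: "finite S" by (rule jfD(1)[OF assms])
  have "jet_on (S \<union> tsh ` S) (full_t c)" if "c \<in> S" for c
    using that S by (cases c) (force simp: full_t_def[abs_def] intro!: jet_on_const jet_on_coord)+
  then have "jet_on (S \<union> tsh ` S) (der full_t F)" using S by (intro jet_on_der[OF assms]) auto
  then show "jet_on (S \<union> tsh ` S) (Dt F)"
    by (rule jet_on_cong) (rule full_der(1)[OF assms, symmetric])
  have "jet_on (S \<union> xsh ` S) (full_x c)" if "c \<in> S" for c
    using that S by (cases c) (force simp: full_x_def[abs_def] intro!: jet_on_const jet_on_coord)+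
  then have "jet_on (S \<union> xsh ` S) (der full_x F)" using S by (intro jet_on_der[OF assms]) auto
  then show "jet_on (S \<union> xsh ` S) (Dx F)"
    by (rule jet_on_cong) (rule full_der(2)[OF assms, symmetric])
qed

lemma supported_Dt: "supported P F \<Longrightarrow> P \<subseteq> Q \<Longrightarrow> tsh ` P \<subseteq> Q \<Longrightarrow> supported Q (Dt F)"
  unfolding supported_def using jet_on_full(1) by (metis Un_least image_mono order_trans)

lemma supported_Dx: "supported P F \<Longrightarrow> P \<subseteq> Q \<Longrightarrow> xsh ` P \<subseteq> Q \<Longrightarrow> supported Q (Dx F)"
  unfolding supported_def using jet_on_full(2) by (metis Un_least image_mono order_trans)

lemma supported_Dx_pow: "supported P F \<Longrightarrow> xsh ` P \<subseteq> P \<Longrightarrow> supported P ((Dx ^^ b) F)"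
  by (induction b) (auto intro: supported_Dx)

lemma supported_Dt_pow: "supported P F \<Longrightarrow> tsh ` P \<subseteq> P \<Longrightarrow> supported P ((Dt ^^ b) F)"
  by (induction b) (auto intro: supported_Dt)

lemma supported_coord: "c \<in> P \<Longrightarrow> supported P (\<lambda>p. p c)"
  by (rule jet_on_supported[OF jet_on_coord[of "{c}"]]) auto

lemma supported_join: assumes "supported P F" "supported P G"
  obtains S where "jet_on S F" "jet_on S G" "S \<subseteq> P"
proof -
  obtain S1 S2 where s: "jet_on S1 F" "jet_on S2 G" "S1 \<subseteq> P" "S2 \<subseteq> P" using assms by (auto simp: supported_def)
  then have "finite (S1 \<union> S2)" by (auto dest: jfD(1))
  then have "jet_on (S1 \<union> S2) F" "jet_on (S1 \<union> S2) G"
    using jet_on_mono[OF s(1), of "S1 \<union> S2"] jet_on_mono[OF s(2), of "S1 \<union> S2"] by auto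
  then show ?thesis using s that by blast
qed

lemma supported_diff: assumes "supported P F" "supported P G" shows "supported P (\<lambda>p. F p - G p)"
  using supported_join[OF assms] jet_on_diff jet_on_supported by metis

lemma Dx_diff: assumes "supported P F" "supported P G" "p \<in> D" shows "Dx (\<lambda>p. F p - G p) p = Dx F p - Dx G p"
proof -
  obtain S where s: "jet_on S F" "jet_on S G" using supported_join[OF assms(1,2)] .
  show ?thesis
    using full_der(2)[OF s(1) assms(3)] full_der(2)[OF s(2) assms(3)]
      full_der(2)[OF jet_on_diff[OF s] assms(3)] der_diff[OF s assms(3)] by simp
qed

lemma Dt_diff: assumes "supported P F" "supported P G" "p \<in> D" shows "Dt (\<lambda>p. F p - G p) p = Dt F p - Dt G p"
proof -
  obtain S where s: "jet_on S F" "jet_on S G" using supported_join[OF assms(1,2)] .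
  show ?thesis
    using full_der(1)[OF s(1) assms(3)] full_der(1)[OF s(2) assms(3)]
      full_der(1)[OF jet_on_diff[OF s] assms(3)] der_diff[OF s assms(3)] by simp
qed

lemma Dx_pow_diff:
  assumes "supported P F" "supported P G" "xsh ` P \<subseteq> P" "p \<in> D"
  shows "(Dx ^^ b) (\<lambda>p. F p - G p) p = (Dx ^^ b) F p - (Dx ^^ b) G p"
  using assms(4)
proof (induction b arbitrary: p)
  case (Suc b)
  show ?case
    using Dx_cong[where F="(Dx ^^ b) (\<lambda>p. F p - G p)" and G="\<lambda>p. (Dx ^^ b) F p - (Dx ^^ b) G p", OF Suc.IH Suc.prems]
      Dx_diff[OF supported_Dx_pow[OF assms(1,3)] supported_Dx_pow[OF assms(2,3)] Suc.prems] by simp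
qed simp

lemma Dt_pow_diff:
  assumes "supported P F" "supported P G" "tsh ` P \<subseteq> P" "p \<in> D"
  shows "(Dt ^^ b) (\<lambda>p. F p - G p) p = (Dt ^^ b) F p - (Dt ^^ b) G p"
  using assms(4)
proof (induction b arbitrary: p)
  case (Suc b)
  show ?case
    using Dt_cong[where F="(Dt ^^ b) (\<lambda>p. F p - G p)" and G="\<lambda>p. (Dt ^^ b) F p - (Dt ^^ b) G p", OF Suc.IH Suc.prems]
      Dt_diff[OF supported_Dt_pow[OF assms(1,3)] supported_Dt_pow[OF assms(2,3)] Suc.prems] by simp
qed simp

lemma Dt_pow_cong:
  assumes "\<And>p. p \<in> D \<Longrightarrow> F p = G p" "p \<in> D"
  shows "(Dt ^^ b) F p = (Dt ^^ b) G p"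
  using assms(2)
proof (induction b arbitrary: p)
  case (Suc b)
  show ?case using Dt_cong[where F="(Dt ^^ b) F" and G="(Dt ^^ b) G", OF Suc.IH Suc.prems] by simp
qed (simp add: assms(1))

lemma total_coord: "p \<in> D \<Longrightarrow> (Dt ^^ a) ((Dx ^^ b) (\<lambda>p. p (J i k l))) p = p (J i (k + a) (l + b))"
proof -
  have x: "(Dx ^^ b) (\<lambda>p. p (J i k l)) p = p (J i k (l + b))" if "p \<in> D" for p b
    using that
  proof (induction b arbitrary: p)
    case (Suc b)
    have "(Dx ^^ Suc b) (\<lambda>p. p (J i k l)) p = Dx (\<lambda>p. p (J i k (l + b))) p"
      using Dx_cong[OF Suc.IH Suc.prems] by simp
    also have "\<dots> = der full_x (\<lambda>p. p (J i k (l + b))) p"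
      by (rule full_der(2)[OF jet_on_coord[of "{J i k (l + b)}"] Suc.prems]) auto
    finally show ?case by (simp add: der_coord full_x_def)
  qed simp
  have t: "(Dt ^^ a) (\<lambda>p. p (J i k l)) p = p (J i (k + a) l)" if "p \<in> D" for p a l
    using that
  proof (induction a arbitrary: p)
    case (Suc a)
    have "(Dt ^^ Suc a) (\<lambda>p. p (J i k l)) p = Dt (\<lambda>p. p (J i (k + a) l)) p"
      using Dt_cong[OF Suc.IH Suc.prems] by simp
    also have "\<dots> = der full_t (\<lambda>p. p (J i (k + a) l)) p"
      by (rule full_der(1)[OF jet_on_coord[of "{J i (k + a) l}"] Suc.prems]) auto
    finally show ?case by (simp add: der_coord full_t_def)
  qed simp
  assume "p \<in> D"
  then show ?thesis
    using Dt_pow_cong[where F="(Dx ^^ b) (\<lambda>p. p (J i k l))" and G="\<lambda>p. p (J i k (l + b))", OF x] t by simp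
qed

lemma cont_fun_coord:
  assumes "continuous_on S g" "\<And>p. p \<in> D \<Longrightarrow> p c \<in> S"
  shows "continuous_on D (\<lambda>p. g (p c) :: real)"
  by (rule continuous_on_compose2[OF assms(1) cont_coord]) (use assms(2) in auto)

text \<open>All derivatives of g are treated at once, since the induction step passes from the k-th
  to the next.\<close>

lemma smooth_upto_real:
  assumes g: "smooth_real_on I g"
  shows "smooth_upto n (\<lambda>p. (deriv ^^ k) g (p (J 0 0 0)))"
proof -
  have c: "continuous_on D (\<lambda>p. (deriv ^^ k) g (p (J 0 0 0)))" for k
  proof -
    have "continuous_on I ((deriv ^^ k) g)"
      using g unfolding smooth_real_on_def
      by (intro continuous_at_imp_continuous_on ballI differentiable_imp_continuous_within) auto
    then show ?thesis using cont_fun_coord[of I _ "J 0 0 0"] by (simp add: in_D)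
  qed
  show ?thesis
  proof (induction n arbitrary: k)
    case 0
    show ?case using c by simp
  next
    case (Suc n)
    have h: "has_pd c (\<lambda>p. (deriv ^^ k) g (p (J 0 0 0))) (if c = J 0 0 0 then (deriv ^^ Suc k) g (p (J 0 0 0)) else 0) p"
      if "p \<in> D" for p c
    proof (rule has_pd_fun[where g="(deriv ^^ k) g" and d="J 0 0 0"])
      have "(deriv ^^ k) g differentiable (at (p (J 0 0 0)))"
        using g that unfolding smooth_real_on_def in_D by blast
      then show "((deriv ^^ k) g has_real_derivative (deriv ^^ Suc k) g (p (J 0 0 0))) (at (p (J 0 0 0)))"
        using DERIV_deriv_iff_real_differentiable by auto
    qed
    show ?case
    proof (rule smooth_upto_SucI[where F'="\<lambda>c p. if c = J 0 0 0 then (deriv ^^ Suc k) g (p (J 0 0 0)) else 0", OF c h])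
      fix c show "smooth_upto n (\<lambda>p. if c = J 0 0 0 then (deriv ^^ Suc k) g (p (J 0 0 0)) else 0)"
      proof (cases "c = J 0 0 0")
        case True
        then show ?thesis using Suc.IH[of "Suc k"] by (simp only: if_True refl)
      next
        case False
        then show ?thesis using smooth_upto_const[of n 0] by simp
      qed
    qed
  qed
qed

end

section \<open>The united potential system and its total derivatives\<close>

abbreviation U :: "nat \<Rightarrow> coord" where "U l \<equiv> J 0 0 l"
abbreviation V1 :: coord where "V1 \<equiv> J (Suc 0) 0 0"
abbreviation V2 :: coord where "V2 \<equiv> J 2 0 0"

text \<open>Both systems have the form $v^1_x = u$, $v^1_t = A u_x + \<kappa> \<integral>A$, $v^2_x = \<phi>(x) u$,
  $v^2_t = \<phi>(x) A u_x + \<psi> \<integral>A$; equality of the mixed derivatives of $v^2$ is the ODE for \<open>\<phi>\<close>.\<close>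

locale potential_system = jets +
  fixes A IA \<phi> :: "real \<Rightarrow> real" and \<kappa> \<psi> :: real
  assumes A_smooth: "smooth_real_on I A"
    and A_nz: "u \<in> I \<Longrightarrow> A u \<noteq> 0"
    and A_not_const: "\<not> (\<exists>a. \<forall>u\<in>I. A u = a)"
    and A_not_frac: "\<not> (\<exists>a b. \<forall>u\<in>I. A u = a / (u + b)^2)"
    and IA: "u \<in> I \<Longrightarrow> (IA has_real_derivative A u) (at u)"
    and \<phi>: "(\<phi> has_real_derivative \<kappa> * \<phi> x - \<psi>) (at x)"
    and \<phi>_nz: "\<kappa> * \<phi> x - \<psi> \<noteq> 0"
begin

text \<open>The independent coordinates on the solution set, with the x-derivatives of u of order below n.\<close>

definition B :: "nat \<Rightarrow> coord set" where
  "B n = {T, X, V1, V2} \<union> U ` {..<n}"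

lemma B: "finite (B n)" "T \<in> B n" "X \<in> B n" "V1 \<in> B n" "V2 \<in> B n" "l < n \<Longrightarrow> U l \<in> B n"
  "m \<le> n \<Longrightarrow> B m \<subseteq> B n" "U l \<in> B n \<longleftrightarrow> l < n"
  by (auto simp: B_def)

lemma jet_on_B_mono: "jet_on (B m) F \<Longrightarrow> m \<le> n \<Longrightarrow> jet_on (B n) F"
  by (rule jet_on_mono[OF _ B(7) B(1)])

lemma dep_single: "c \<in> S \<Longrightarrow> dep S (\<lambda>p. g (p c))"
  unfolding dep_def by simp

lemma jet_on_A: "finite S \<Longrightarrow> U 0 \<in> S \<Longrightarrow> jet_on S (\<lambda>p. A (p (U 0)))"
  using smooth_upto_real[OF A_smooth, of _ 0] by (simp add: jet_on_def smooth_def dep_single)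

lemma jet_on_A': "finite S \<Longrightarrow> U 0 \<in> S \<Longrightarrow> jet_on S (\<lambda>p. deriv A (p (U 0)))"
  using smooth_upto_real[OF A_smooth, of _ 1] by (simp add: jet_on_def smooth_def dep_single)

lemma A_deriv: "u \<in> I \<Longrightarrow> (A has_real_derivative deriv A u) (at u)"
  using A_smooth unfolding smooth_real_on_def
  by (metis DERIV_deriv_iff_real_differentiable funpow_0)

lemma jet_on_IA: assumes "finite S" "U 0 \<in> S" shows "jet_on S (\<lambda>p. IA (p (U 0)))"
proof -
  have c: "continuous_on D (\<lambda>p. IA (p (U 0)))"
    by (rule cont_fun_coord[OF DERIV_continuous_on[OF has_field_derivative_at_within[OF IA]]])
       (simp_all add: in_D)
  have "smooth_upto n (\<lambda>p. IA (p (U 0)))" for n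
  proof (cases n)
    case (Suc m)
    have h: "has_pd c (\<lambda>p. IA (p (U 0))) (if c = U 0 then A (p (U 0)) else 0) p" if "p \<in> D" for p c
      by (rule has_pd_fun[where g=IA and d="U 0"]) (use that IA in \<open>simp add: in_D\<close>)
    show ?thesis unfolding Suc
    proof (rule smooth_upto_SucI[where F'="\<lambda>c p. if c = U 0 then A (p (U 0)) else 0", OF c h])
      fix c show "smooth_upto m (\<lambda>p. if c = U 0 then A (p (U 0)) else 0)"
        using smooth_upto_const[of m 0] smooth_upto_real[OF A_smooth, of m 0] by (cases "c = U 0") simp_all
    qed
  qed (use c in simp)
  then show ?thesis using assms by (simp add: jet_on_def smooth_def dep_single)
qed

text \<open>A solution of a first-order linear ODE with constant coefficients has a derivative that
  is affine in itself, so smoothness bootstraps. Applied to \<phi> and to the reciprocal of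
  \<phi>'.\<close>

lemma jet_on_ode:
  assumes g: "\<And>x. (g has_real_derivative \<alpha> * g x + \<beta>) (at x)" and "finite S" "X \<in> S"
  shows "jet_on S (\<lambda>p. g (p X))"
proof -
  have c: "continuous_on D (\<lambda>p. g (p X))"
    by (rule cont_fun_coord[OF DERIV_continuous_on[OF g]]) simp
  have "smooth_upto n (\<lambda>p. g (p X))" for n
  proof (induction n)
    case (Suc n)
    have h: "has_pd c (\<lambda>p. g (p X)) (if c = X then \<alpha> * g (p X) + \<beta> else 0) p" if "p \<in> D" for p c
      by (rule has_pd_fun[where g=g and d=X]) (rule g)
    show ?case
    proof (rule smooth_upto_SucI[where F'="\<lambda>c p. if c = X then \<alpha> * g (p X) + \<beta> else 0", OF c h])
      fix c show "smooth_upto n (\<lambda>p. if c = X then \<alpha> * g (p X) + \<beta> else 0)"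
        using smooth_upto_add[OF smooth_upto_mult[OF smooth_upto_const[of n \<alpha>] Suc] smooth_upto_const[of n \<beta>]] smooth_upto_const[of n 0]
        by (cases "c = X") simp_all
    qed
  qed (use c in simp)
  then show ?thesis using assms by (simp add: jet_on_def smooth_def dep_single)
qed

lemma jet_on_\<phi>: "finite S \<Longrightarrow> X \<in> S \<Longrightarrow> jet_on S (\<lambda>p. \<phi> (p X))"
  by (rule jet_on_ode[of _ \<kappa> "-\<psi>"]) (use \<phi> in auto)

lemma pd_A: "p \<in> D \<Longrightarrow> pd c (\<lambda>p. A (p (U 0))) p = (if c = U 0 then deriv A (p (U 0)) else 0)"
  by (rule has_pd_pd[OF has_pd_fun]) (rule A_deriv, simp add: in_D)

lemma pd_IA: "p \<in> D \<Longrightarrow> pd c (\<lambda>p. IA (p (U 0))) p = (if c = U 0 then A (p (U 0)) else 0)"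
  by (rule has_pd_pd[OF has_pd_fun]) (rule IA, simp add: in_D)

lemma pd_\<phi>: "pd c (\<lambda>p. \<phi> (p X)) p = (if c = X then \<kappa> * \<phi> (p X) - \<psi> else 0)"
  by (rule has_pd_pd[OF has_pd_fun]) (rule \<phi>)

text \<open>The prescribed v^1_t, and below it v^2_t; they are minus the fluxes of the densities u
  and \<phi> u.\<close>

definition \<tau>1 :: "jpt \<Rightarrow> real" where
  "\<tau>1 p = A (p (U 0)) * p (U 1) + \<kappa> * IA (p (U 0))"

definition \<tau>2 :: "jpt \<Rightarrow> real" where
  "\<tau>2 p = \<phi> (p X) * (A (p (U 0)) * p (U 1)) + \<psi> * IA (p (U 0))"

text \<open>\<open>HX\<close> and \<open>HT\<close> are the total derivatives on the solution set in its independent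
  coordinates, and \<open>K\<close> is the right-hand side of the evolution equation $u_t = K$.\<close>

definition bx :: "coord \<Rightarrow> jpt \<Rightarrow> real" where
  "bx c p = (case c of T \<Rightarrow> 0 | X \<Rightarrow> 1 | J i k l \<Rightarrow>
     if c = V1 then p (U 0) else if c = V2 then \<phi> (p X) * p (U 0) else p (J i k (Suc l)))"

definition HX :: "(jpt \<Rightarrow> real) \<Rightarrow> jpt \<Rightarrow> real" where "HX = der bx"

definition K :: "jpt \<Rightarrow> real" where "K = HX \<tau>1"

definition bt :: "coord \<Rightarrow> jpt \<Rightarrow> real" where
  "bt c p = (case c of T \<Rightarrow> 1 | X \<Rightarrow> 0 | J i k l \<Rightarrow>
     if c = V1 then \<tau>1 p else if c = V2 then \<tau>2 p else (HX ^^ l) K p)"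

definition HT :: "(jpt \<Rightarrow> real) \<Rightarrow> jpt \<Rightarrow> real" where "HT = der bt"

lemma bx: "bx T = (\<lambda>p. 0)" "bx X = (\<lambda>p. 1)" "bx V1 = (\<lambda>p. p (U 0))"
    "bx V2 = (\<lambda>p. \<phi> (p X) * p (U 0))" "bx (U l) = (\<lambda>p. p (U (Suc l)))"
  and bt: "bt T = (\<lambda>p. 1)" "bt X = (\<lambda>p. 0)" "bt V1 = \<tau>1" "bt V2 = \<tau>2" "bt (U l) = (HX ^^ l) K"
  by (simp_all add: bx_def bt_def fun_eq_iff)

lemma B_cases:
  assumes "c \<in> B n" obtains "c = T" | "c = X" | "c = V1" | "c = V2" | l where "c = U l" "l < n"
  using assms by (auto simp: B_def)

lemma jet_on_\<tau>1: "2 \<le> n \<Longrightarrow> jet_on (B n) \<tau>1"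
  unfolding \<tau>1_def[abs_def] by (intro jet_on_add jet_on_mult jet_on_A jet_on_IA jet_on_const jet_on_coord B) auto

lemma jet_on_\<tau>2: "2 \<le> n \<Longrightarrow> jet_on (B n) \<tau>2"
  unfolding \<tau>2_def[abs_def] by (intro jet_on_add jet_on_mult jet_on_A jet_on_IA jet_on_const jet_on_coord jet_on_\<phi> B) auto

lemma jet_on_bx: assumes "c \<in> B n" shows "jet_on (B (Suc n)) (bx c)"
  using assms
  by (cases rule: B_cases)
     (auto simp only: bx intro!: jet_on_mult jet_on_const jet_on_coord jet_on_\<phi> B(1-6))

lemma jet_on_HX: "jet_on (B n) F \<Longrightarrow> jet_on (B (Suc n)) (HX F)"
  unfolding HX_def by (rule jet_on_der[OF _ jet_on_bx]) (rule B | simp)+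

text \<open>K has order two in u, each \<open>HX\<close> adds one, and the bound in \<open>B\<close>
  is exclusive; hence l + 3.\<close>

lemma jet_on_K: "jet_on (B (l + 3)) ((HX ^^ l) K)"
proof (induction l)
  case 0
  show ?case using jet_on_HX[OF jet_on_\<tau>1[of 2]] by (simp add: K_def eval_nat_numeral)
next
  case (Suc l)
  then show ?case using jet_on_HX[OF Suc] by simp
qed

lemma jet_on_bt: assumes "c \<in> B n" shows "jet_on (B (n + 2)) (bt c)"
  using assms
proof (cases rule: B_cases)
  case (5 l)
  then show ?thesis using jet_on_B_mono[OF jet_on_K[of l]] by (simp add: bt)
qed (auto simp only: bt intro!: jet_on_const jet_on_\<tau>1 jet_on_\<tau>2 B(1))

lemma jet_on_HT: "jet_on (B n) F \<Longrightarrow> jet_on (B (n + 2)) (HT F)"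
  unfolding HT_def by (rule jet_on_der[OF _ jet_on_bt]) (rule B | simp)+

lemma HX_\<phi>: "HX (\<lambda>p. \<phi> (p X)) p = \<kappa> * \<phi> (p X) - \<psi>"
  using der_fun[OF \<phi>, where c=X and p=p and \<xi>=bx] by (simp add: HX_def bx)

lemma HT_\<phi>: "HT (\<lambda>p. \<phi> (p X)) p = 0"
  using der_fun[OF \<phi>, where c=X and p=p and \<xi>=bt] by (simp add: HT_def bt)

lemma HX_A: "p \<in> D \<Longrightarrow> HX (\<lambda>p. A (p (U 0))) p = deriv A (p (U 0)) * p (U 1)"
  using der_fun[OF A_deriv, where c="U 0" and p=p and \<xi>=bx] by (simp add: HX_def bx in_D)

lemma HX_IA: "p \<in> D \<Longrightarrow> HX (\<lambda>p. IA (p (U 0))) p = A (p (U 0)) * p (U 1)"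
  using der_fun[OF IA, where c="U 0" and p=p and \<xi>=bx] by (simp add: HX_def bx in_D)

lemma HX_coord: "HX (\<lambda>p. p c) = bx c"
  by (simp add: HX_def der_coord fun_eq_iff)

lemma HT_coord: "HT (\<lambda>p. p c) = bt c"
  by (simp add: HT_def der_coord fun_eq_iff)

text \<open>Compatibility of the two equations for v^2: the contributions of \<phi>' and of
  \<psi>\<integral>A add up to \<kappa>\<phi> A u_x by the ODE for \<phi>.\<close>

lemma HX_\<tau>2: assumes p: "p \<in> D" shows "HX \<tau>2 p = \<phi> (p X) * K p"
proof -
  define w where "w = (\<lambda>p. A (p (U 0)) * p (U 1))"
  have jw: "jet_on (B 2) w" unfolding w_def by (intro jet_on_mult jet_on_A jet_on_coord B) auto
  have ji: "jet_on (B 2) (\<lambda>p. IA (p (U 0)))" "jet_on (B 2) (\<lambda>p. \<phi> (p X))" "jet_on (B 2) (\<lambda>p. a)" for a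
    by (intro jet_on_IA jet_on_\<phi> jet_on_const B; simp)+
  have \<tau>: "\<tau>1 = (\<lambda>p. w p + \<kappa> * IA (p (U 0)))" "\<tau>2 = (\<lambda>p. \<phi> (p X) * w p + \<psi> * IA (p (U 0)))"
    by (simp_all add: \<tau>1_def \<tau>2_def w_def fun_eq_iff)
  have "K p = HX w p + \<kappa> * (A (p (U 0)) * p (U 1))"
    unfolding K_def \<tau> HX_def
    using HX_IA[OF p]
    by (simp add: der_add[OF jw jet_on_mult[OF ji(3,1)] p] der_mult[OF ji(3,1) p] der_const HX_def)
  moreover have "HX \<tau>2 p = (\<kappa> * \<phi> (p X) - \<psi>) * w p + \<phi> (p X) * HX w p + \<psi> * (A (p (U 0)) * p (U 1))"
    unfolding \<tau> HX_def
    using HX_IA[OF p] HX_\<phi>[of p]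
    by (simp add: der_add[OF jet_on_mult[OF ji(2) jw] jet_on_mult[OF ji(3,1)] p] der_mult[OF ji(3,1) p]
      der_mult[OF ji(2) jw p] der_const HX_def)
  ultimately show ?thesis by (simp add: w_def algebra_simps)
qed

text \<open>Integrability of the system. Commutation is checked on coordinates: for v^1 and the
  derivatives of u it holds by the definitions of K and \<open>bt\<close>, and for v^2 it is
  \<open>HX_\<tau>2\<close>.\<close>

lemma HX_HT:
  assumes F: "jet_on (B n) F" and p: "p \<in> D"
  shows "HX (HT F) p = HT (HX F) p"
  unfolding HX_def HT_def
proof (rule der_commute[OF F])
  show "jet_on (B (n + 2)) (bx c)" "jet_on (B (n + 2)) (bt c)" if "c \<in> B n" for c
    using jet_on_B_mono[OF jet_on_bx[OF that]] jet_on_bt[OF that] by auto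
  fix c assume "c \<in> B n"
  then show "der bx (bt c) p = der bt (bx c) p"
  proof (cases rule: B_cases)
    case 3
    then show ?thesis using HT_coord[of "U 0"] by (simp add: bx bt K_def HX_def HT_def)
  next
    case 4
    have "der bt (\<lambda>p. \<phi> (p X) * p (U 0)) p = \<phi> (p X) * K p"
      using der_mult[OF jet_on_\<phi>[of "B 1"] jet_on_coord[of "B 1" "U 0"] p, of bt] HT_\<phi>[of p]
      by (simp add: B HT_def der_coord bt)
    then show ?thesis using 4 HX_\<tau>2[OF p] by (simp add: bx bt HX_def)
  next
    case (5 l)
    then show ?thesis using HT_coord[of "U (Suc l)"] by (simp add: bx bt HX_def HT_def)
  qed (simp_all add: bx bt der_const)
qed (simp_all add: B(1,7) p)

text \<open>The retraction of the jet space onto the solution set.\<close>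

definition R :: "jpt \<Rightarrow> jpt" where
  "R p c = (case c of T \<Rightarrow> p T | X \<Rightarrow> p X | J i k l \<Rightarrow>
     if i < 3 then (HT ^^ k) ((HX ^^ l) (\<lambda>p. p (J i 0 0))) p else p c)"

definition base :: "(jpt \<Rightarrow> real) \<Rightarrow> bool" where
  "base F \<longleftrightarrow> (\<exists>n. jet_on (B n) F)"

abbreviation valid :: "coord set" where "valid \<equiv> {c. valid_coord 3 c}"

lemma base_I: "jet_on (B n) F \<Longrightarrow> base F" by (auto simp: base_def)

lemma base_HX: "base F \<Longrightarrow> base (HX F)" unfolding base_def using jet_on_HX by blast
lemma base_HT: "base F \<Longrightarrow> base (HT F)" unfolding base_def using jet_on_HT by blast
lemma base_HX_pow: "base F \<Longrightarrow> base ((HX ^^ l) F)" by (induction l) (auto intro: base_HX)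
lemma base_HT_pow: "base F \<Longrightarrow> base ((HT ^^ l) F)" by (induction l) (auto intro: base_HT)

lemma base_coord: "i < 3 \<Longrightarrow> base (\<lambda>p. p (J i 0 0))"
proof -
  assume "i < 3"
  then have "J i 0 0 \<in> B 1" by (auto simp: B_def less_Suc_eq eval_nat_numeral)
  then show ?thesis by (intro base_I[of 1] jet_on_coord B)
qed

lemma HX_pow_U: "(HX ^^ l) (\<lambda>p. p (U m)) = (\<lambda>p. p (U (m + l)))"
  by (induction l) (auto simp: HX_coord bx)

lemma R_base: "c \<in> B n \<Longrightarrow> R p c = p c"
  by (erule B_cases) (simp_all add: R_def HX_pow_U)

lemma R_D: "p \<in> D \<Longrightarrow> R p \<in> D"
  using R_base[of "U 0" 1 p] by (simp add: in_D B)

lemma base_R: "valid_coord 3 c \<Longrightarrow> base (\<lambda>p. R p c)"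
proof (cases c)
  case (J i k l)
  assume "valid_coord 3 c"
  then show ?thesis using J by (simp add: R_def base_HT_pow base_HX_pow base_coord)
qed (auto simp: R_def intro!: base_I[of 0] jet_on_coord B)

lemma smooth_R: "smooth (\<lambda>p. R p c)"
proof (cases "valid_coord 3 c")
  case True
  then show ?thesis using base_R jfD(3) unfolding base_def by blast
next
  case False
  then have "(\<lambda>p. R p c) = (\<lambda>p. p c)" by (cases c) (auto simp: R_def)
  then show ?thesis by (simp add: smooth_def smooth_upto_coord)
qed

lemma jet_on_R:
  assumes "finite S" "S \<subseteq> valid"
  shows "\<exists>N. \<forall>c\<in>S. jet_on (B N) (\<lambda>p. R p c)"
    using assms
  proof (induction S rule: finite_induct)
    case (insert c S)
    then obtain N where N: "\<forall>c\<in>S. jet_on (B N) (\<lambda>p. R p c)" by auto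
    obtain M where M: "jet_on (B M) (\<lambda>p. R p c)" using base_R[of c] insert.prems by (auto simp: base_def)
    show ?case
      by (rule exI[of _ "N + M"]) (use N M jet_on_B_mono[of N _ "N + M"] jet_on_B_mono[of M _ "N + M"] in simp)
  qed auto

lemma base_comp_R: "supported valid F \<Longrightarrow> base (\<lambda>p. F (R p))"
proof -
  assume "supported valid F"
  then obtain S where S: "jet_on S F" "S \<subseteq> valid" by (auto simp: supported_def)
  obtain N where N: "\<And>c. c \<in> S \<Longrightarrow> jet_on (B N) (\<lambda>p. R p c)" using jet_on_R[OF jfD(1)[OF S(1)] S(2)] by auto
  show ?thesis by (rule base_I[OF jet_on_comp[OF S(1) R_D smooth_R N B(1)]])
qed

lemma HX_cong: "(\<And>p. p \<in> D \<Longrightarrow> F p = G p) \<Longrightarrow> p \<in> D \<Longrightarrow> HX F p = HX G p"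
  unfolding HX_def by (rule der_cong)

lemma HT_cong: "(\<And>p. p \<in> D \<Longrightarrow> F p = G p) \<Longrightarrow> p \<in> D \<Longrightarrow> HT F p = HT G p"
  unfolding HT_def by (rule der_cong)

lemma HX_HT_pow: "base F \<Longrightarrow> p \<in> D \<Longrightarrow> HX ((HT ^^ k) F) p = (HT ^^ k) (HX F) p"
proof (induction k arbitrary: p)
  case (Suc k)
  obtain n where "jet_on (B n) ((HT ^^ k) F)" using base_HT_pow[OF Suc.prems(1)] by (auto simp: base_def)
  from HX_HT[OF this Suc.prems(2)]
  have "HX ((HT ^^ Suc k) F) p = HT (HX ((HT ^^ k) F)) p" by simp
  also have "\<dots> = HT ((HT ^^ k) (HX F)) p"
    by (rule HT_cong[OF Suc.IH[OF Suc.prems(1)] Suc.prems(2)])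
  finally show ?case by simp
qed simp

text \<open>A shift of an index of a component of R is an application of \<open>HT\<close> or
  \<open>HX\<close>, by the way R is defined; for the x-shift \<open>HX\<close> first has to be
  moved past the powers of \<open>HT\<close>. The chain rule extends this from components to
  F.\<close>

lemma transfer:
  assumes "supported valid F" "p \<in> D"
  shows "HX (\<lambda>p. F (R p)) p = Dx F (R p)" "HT (\<lambda>p. F (R p)) p = Dt F (R p)"
proof -
  obtain S where S: "jet_on S F" "S \<subseteq> valid" using assms(1) by (auto simp: supported_def)
  obtain N where N: "\<And>c. c \<in> S \<Longrightarrow> jet_on (B N) (\<lambda>p. R p c)" using jet_on_R[OF jfD(1)[OF S(1)] S(2)] by auto
  have x: "HX (\<lambda>p. R p c) p = full_x c (R p)" if "c \<in> S" for c
  proof (cases c)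
    case (J i k l)
    then have "i < 3" using S that by auto
    then show ?thesis
      using HX_HT_pow[OF base_HX_pow[OF base_coord] assms(2), of i k l] J by (simp add: R_def full_x_def)
  qed (simp_all add: R_def HX_coord bx full_x_def)
  have t: "HT (\<lambda>p. R p c) p = full_t c (R p)" if "c \<in> S" for c
  proof (cases c)
    case (J i k l)
    then have "i < 3" using S that by auto
    then show ?thesis using J by (simp add: R_def full_t_def)
  qed (simp_all add: R_def HT_coord bt full_t_def)
  note e = der_expand[OF S(1) subset_refl jfD(1)[OF S(1)] R_D[OF assms(2)]]
  have c: "der \<xi> (\<lambda>p. F (R p)) p = (\<Sum>c\<in>S. pd c F (R p) * der \<xi> (\<lambda>p. R p c) p)" for \<xi>
    by (rule der_comp[where S'="B N"]) (use S R_D smooth_R N B(1) assms(2) in auto)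
  show "HX (\<lambda>p. F (R p)) p = Dx F (R p)"
    unfolding full_der(2)[OF S(1) R_D[OF assms(2)]] e HX_def c
    by (rule sum.cong) (use x in \<open>auto simp: HX_def\<close>)
  show "HT (\<lambda>p. F (R p)) p = Dt F (R p)"
    unfolding full_der(1)[OF S(1) R_D[OF assms(2)]] e HT_def c
    by (rule sum.cong) (use t in \<open>auto simp: HT_def\<close>)
qed

lemma shift_valid: "tsh ` valid \<subseteq> valid" "xsh ` valid \<subseteq> valid"
proof -
  have "valid_coord 3 (tsh c)" "valid_coord 3 (xsh c)" if "valid_coord 3 c" for c
    using that by (cases c; simp)+
  then show "tsh ` valid \<subseteq> valid" "xsh ` valid \<subseteq> valid" by auto
qed

lemma transfer_pow:
  assumes F: "supported valid F" and p: "p \<in> D"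
  shows "(Dt ^^ a) ((Dx ^^ b) F) (R p) = (HT ^^ a) ((HX ^^ b) (\<lambda>p. F (R p))) p"
proof -
  have x: "(Dx ^^ b) F (R p) = (HX ^^ b) (\<lambda>p. F (R p)) p" if "p \<in> D" for p
    using that
  proof (induction b arbitrary: p)
    case (Suc b)
    show ?case
      using transfer(1)[OF supported_Dx_pow[OF F shift_valid(2)] Suc.prems, of b] HX_cong[where F="\<lambda>p. (Dx ^^ b) F (R p)"
          and G="(HX ^^ b) (\<lambda>p. F (R p))", OF Suc.IH Suc.prems] by simp
  qed simp
  show ?thesis using p
  proof (induction a arbitrary: p)
    case (Suc a)
    show ?case
      using transfer(2)[OF supported_Dt_pow[OF supported_Dx_pow[OF F shift_valid(2)] shift_valid(1)] Suc.prems]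
        HT_cong[where F="\<lambda>p. (Dt ^^ a) ((Dx ^^ b) F) (R p)"
          and G="(HT ^^ a) ((HX ^^ b) (\<lambda>p. F (R p)))", OF Suc.IH Suc.prems] by simp
  qed (use x in simp)
qed

subsection \<open>Solutions of the system\<close>

definition eqs :: "(jpt \<Rightarrow> real) list" where
  "eqs = [\<lambda>p. p (J (Suc 0) 0 (Suc 0)) - p (U 0), \<lambda>p. p (J (Suc 0) (Suc 0) 0) - \<tau>1 p,
     \<lambda>p. p (J 2 0 (Suc 0)) - \<phi> (p X) * p (U 0), \<lambda>p. p (J 2 (Suc 0) 0) - \<tau>2 p]"

text \<open>Jets of u filtered by the number of t-derivatives. The right-hand sides of the system
  live in \<open>W 0\<close> and each \<open>Dt\<close> raises the level by one, which sets up the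
  induction in \<open>sol_unique\<close>.\<close>

definition W :: "nat \<Rightarrow> coord set" where
  "W a = {T, X} \<union> {J 0 k l |k l. k \<le> a}"

lemma W: "W a \<subseteq> valid" "xsh ` W a \<subseteq> W a" "tsh ` W a \<subseteq> W (Suc a)" "W a \<subseteq> W (Suc a)"
  by (auto simp: W_def)

lemma supported_rhs: "supported (W 0) \<tau>1" "supported (W 0) \<tau>2" "supported (W 0) (\<lambda>p. \<phi> (p X) * p (U 0))" "supported (W 0) (\<lambda>p. p (U 0))"
proof -
  have "jet_on {X, U 0, U 1} \<tau>1" unfolding \<tau>1_def[abs_def] by (intro jet_on_add jet_on_mult jet_on_A jet_on_IA jet_on_const jet_on_coord) auto
  then show "supported (W 0) \<tau>1" by (rule jet_on_supported) (auto simp: W_def)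
  have "jet_on {X, U 0, U 1} \<tau>2" unfolding \<tau>2_def[abs_def] by (intro jet_on_add jet_on_mult jet_on_A jet_on_IA jet_on_\<phi> jet_on_const jet_on_coord) auto
  then show "supported (W 0) \<tau>2" by (rule jet_on_supported) (auto simp: W_def)
  have "jet_on {X, U 0} (\<lambda>p. \<phi> (p X) * p (U 0))" by (intro jet_on_mult jet_on_\<phi> jet_on_coord) auto
  then show "supported (W 0) (\<lambda>p. \<phi> (p X) * p (U 0))" by (rule jet_on_supported) (auto simp: W_def)
  show "supported (W 0) (\<lambda>p. p (U 0))" by (rule supported_coord) (simp add: W_def)
qed

lemma supported_total: "supported (W 0) F \<Longrightarrow> supported (W a) ((Dt ^^ a) ((Dx ^^ b) F))"
proof (induction a)
  case (Suc a)
  then show ?case using supported_Dt[OF _ W(4) W(3)] by simp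
qed (simp add: supported_Dx_pow W)

lemma supported_eqs: "E \<in> set eqs \<Longrightarrow> supported valid E"
  using supported_rhs[THEN supported_mono[OF _ W(1)]]
  by (auto simp: eqs_def intro!: supported_diff supported_coord)

text \<open>Linearity of the total derivatives puts each differential consequence into solved
  form.\<close>

lemma sol_total:
  assumes "p \<in> sol_set D eqs" "(\<lambda>p. p (J i k l) - F p) \<in> set eqs" "supported (W 0) F" "i < 3"
  shows "p (J i (k + a) (l + b)) = (Dt ^^ a) ((Dx ^^ b) F) p"
proof -
  have p: "p \<in> D" and 0: "(Dt ^^ a) ((Dx ^^ b) (\<lambda>p. p (J i k l) - F p)) p = 0"
    using assms(1,2) by (auto simp: sol_set_def)
  have c: "supported valid (\<lambda>p. p (J i k l))" "supported valid F"
    using supported_mono[OF assms(3) W(1)] assms(4) by (auto intro: supported_coord)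
  have "(Dt ^^ a) ((Dx ^^ b) (\<lambda>p. p (J i k l) - F p)) p =
     (Dt ^^ a) (\<lambda>p. (Dx ^^ b) (\<lambda>p. p (J i k l)) p - (Dx ^^ b) F p) p"
    by (rule Dt_pow_cong[OF Dx_pow_diff[OF c shift_valid(2)] p])
  also have "\<dots> = (Dt ^^ a) ((Dx ^^ b) (\<lambda>p. p (J i k l))) p - (Dt ^^ a) ((Dx ^^ b) F) p"
    by (rule Dt_pow_diff[OF supported_Dx_pow[OF c(1) shift_valid(2)] supported_Dx_pow[OF c(2) shift_valid(2)] shift_valid(1) p])
  finally show ?thesis using 0 total_coord[OF p] by simp
qed

text \<open>The equation u_t = K is not listed in the system, so t-derivatives of u are reached
  through v^1: a mixed derivative of v^1 is a derivative of u by the first equation, and by the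
  second a function of jets of u with one t-derivative less.\<close>

lemma sol_unique:
  assumes p: "p \<in> sol_set D eqs" and q: "q \<in> sol_set D eqs"
    and base: "\<And>n c. c \<in> B n \<Longrightarrow> p c = q c" and c: "valid_coord 3 c"
  shows "p c = q c"
proof -
  have D: "p \<in> D" "q \<in> D" using p q by (auto simp: sol_set_def)
  have TX: "p T = q T" "p X = q X" using base[of _ 0] B by auto
  have eq: "p (J i (k + a) (l + b)) = q (J i (k + a) (l + b))"
    if "(\<lambda>p. p (J i k l) - F p) \<in> set eqs" "supported (W 0) F" "i < 3" "\<And>c. c \<in> W a \<Longrightarrow> p c = q c" for i k l a b F
    unfolding sol_total[OF p that(1-3)] sol_total[OF q that(1-3)]
    by (rule supported_eq[OF supported_total[OF that(2)] D that(4)])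
  have step: "p (J (Suc 0) a (Suc b)) = q (J (Suc 0) a (Suc b)) \<and> p (J (Suc 0) (Suc a) b) = q (J (Suc 0) (Suc a) b) \<and>
     p (J 2 a (Suc b)) = q (J 2 a (Suc b)) \<and> p (J 2 (Suc a) b) = q (J 2 (Suc a) b)"
    if W: "\<And>c. c \<in> W a \<Longrightarrow> p c = q c" for a b
    using eq[of "Suc 0" 0 "Suc 0" _ a b, OF _ supported_rhs(4) _ W] eq[of "Suc 0" "Suc 0" 0 _ a b, OF _ supported_rhs(1) _ W]
      eq[of 2 0 "Suc 0" _ a b, OF _ supported_rhs(3) _ W] eq[of 2 "Suc 0" 0 _ a b, OF _ supported_rhs(2) _ W]
    by (simp add: eqs_def)
  have U_total: "r (J (Suc 0) a (Suc b)) = r (J 0 a b)" if "r \<in> sol_set D eqs" for r a b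
  proof -
    have "r (J (Suc 0) (0 + a) (Suc 0 + b)) = (Dt ^^ a) ((Dx ^^ b) (\<lambda>p. p (J 0 0 0))) r"
      by (rule sol_total[OF that _ supported_rhs(4)]) (simp_all add: eqs_def)
    then show ?thesis using total_coord[where p=r and a=a and b=b and i=0 and k=0 and l=0] that by (simp add: sol_set_def)
  qed
  have W: "p c = q c" if "c \<in> W a" for c a
    using that
  proof (induction a arbitrary: c)
    case 0
    then show ?case using TX base[of "U _" "Suc _"] B(6) by (auto simp: W_def)
  next
    case (Suc a)
    show ?case
    proof (cases "c \<in> W a")
      case False
      then obtain l where l: "c = J 0 (Suc a) l" using Suc.prems by (auto simp: W_def le_Suc_eq)
      \<comment> \<open>The coordinate of v^1 with indices Suc a, Suc l is read in both
        ways.\<close>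
      show ?thesis
        using step[of a "Suc l"] Suc.IH U_total[OF p, of "Suc a" l] U_total[OF q, of "Suc a" l] l by simp
    qed (rule Suc.IH)
  qed
  have step: "p (J (Suc 0) a (Suc b)) = q (J (Suc 0) a (Suc b))" "p (J (Suc 0) (Suc a) b) = q (J (Suc 0) (Suc a) b)"
     "p (J 2 a (Suc b)) = q (J 2 a (Suc b))" "p (J 2 (Suc a) b) = q (J 2 (Suc a) b)" for a b
    using step[of a b] W by auto
  show ?thesis
  proof (cases c)
    case (J i k l)
    then consider "i = 0" | "i = Suc 0" | "i = 2" using c by fastforce
    then show ?thesis
    proof cases
      case 1
      then show ?thesis using W[of c k] J by (simp add: W_def)
    next
      case 2
      then show ?thesis using J step(1,2) base[of V1 0] B by (cases k; cases l) auto
    next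
      case 3
      then show ?thesis using J step(3,4) base[of V2 0] B by (cases k; cases l) auto
    qed
  qed (use TX in auto)
qed

lemma HX_0: "(\<And>p. p \<in> D \<Longrightarrow> F p = 0) \<Longrightarrow> p \<in> D \<Longrightarrow> HX F p = 0"
  using HX_cong[of F "\<lambda>p. 0"] by (simp add: HX_def der_const)

lemma HT_0: "(\<And>p. p \<in> D \<Longrightarrow> F p = 0) \<Longrightarrow> p \<in> D \<Longrightarrow> HT F p = 0"
  using HT_cong[of F "\<lambda>p. 0"] by (simp add: HT_def der_const)

lemma R_rhs: "\<tau>1 (R p) = \<tau>1 p" "\<tau>2 (R p) = \<tau>2 p"
  using R_base[of "U 0" 2 p] R_base[of "U (Suc 0)" 2 p] R_base[of X 0 p]
  by (simp_all add: \<tau>1_def \<tau>2_def B)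

text \<open>Composed with R, the four equations become identities in p; hence all their
  \<open>HX\<close>- and \<open>HT\<close>-derivatives vanish, and by \<open>transfer_pow\<close>
  these are the differential consequences at R p.\<close>

lemma R_sol: assumes p: "p \<in> D" shows "R p \<in> sol_set D eqs"
proof -
  have "(Dt ^^ a) ((Dx ^^ b) E) (R p) = 0" if E: "E \<in> set eqs" for E a b
  proof -
    have "E (R p) = 0" for p
      using E R_base[of "U 0" 1 p] R_base[of X 0 p]
      by (auto simp: eqs_def R_rhs B) (simp_all add: R_def HX_coord HT_coord bx bt)
    then have "(HX ^^ b) (\<lambda>p. E (R p)) p = 0" if "p \<in> D" for p
      using that by (induction b arbitrary: p) (auto intro: HX_0)
    then have "(HT ^^ a) ((HX ^^ b) (\<lambda>p. E (R p))) p = 0"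
      using p by (induction a arbitrary: p) (auto intro: HT_0)
    then show ?thesis using transfer_pow[OF supported_eqs[OF E] p] by simp
  qed
  then show ?thesis using R_D[OF p] by (auto simp: sol_set_def)
qed

lemma sol_R:
  assumes "p \<in> sol_set D eqs" "valid_coord 3 c"
  shows "p c = R p c"
  using sol_unique[OF assms(1) R_sol _ assms(2), of p] R_base assms(1) by (auto simp: sol_set_def)

lemma base_valid: "base F \<Longrightarrow> supported valid F"
  unfolding base_def by (elim exE) (erule jet_on_supported, auto simp: B_def)

lemma base_R_eq: "base F \<Longrightarrow> p \<in> D \<Longrightarrow> F (R p) = F p"
  unfolding base_def using depD[OF jfD(2) R_D] R_base by blast

text \<open>Pulling back along R turns the law into an identity on all of D. A potential H found
  there is already a function on the jet space, and it is unchanged by R because it involves the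
  free coordinates only.\<close>

theorem trivial_from_base:
  assumes main: "\<And>F G. base F \<Longrightarrow> base G \<Longrightarrow> (\<And>p. p \<in> D \<Longrightarrow> HT F p + HX G p = 0) \<Longrightarrow>
     \<exists>H. base H \<and> (\<forall>p\<in>D. F p = HX H p \<and> G p = - HT H p)"
    and cl: "conservation_law 3 D eqs F G"
  shows "trivial_cl 3 D eqs F G"
proof -
  have FG: "supported valid F" "supported valid G" using cl by (auto simp: conservation_law_def jet_fun_iff)
  have "HT (\<lambda>p. F (R p)) p + HX (\<lambda>p. G (R p)) p = 0" if "p \<in> D" for p
    using transfer(2)[OF FG(1) that] transfer(1)[OF FG(2) that] R_sol[OF that] cl
    by (simp add: conservation_law_def)
  then obtain H where H: "base H" "\<And>p. p \<in> D \<Longrightarrow> F (R p) = HX H p" "\<And>p. p \<in> D \<Longrightarrow> G (R p) = - HT H p"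
    using main[OF base_comp_R[OF FG(1)] base_comp_R[OF FG(2)]] by blast
  have cH: "supported valid H" by (rule base_valid[OF H(1)])
  have "F p - Dx H p = 0 \<and> G p + Dt H p = 0" if p: "p \<in> sol_set D eqs" for p
  proof -
    have pD: "p \<in> D" using p by (simp add: sol_set_def)
    have R: "M p = M (R p)" if "supported valid M" for M
      by (rule supported_eq[OF that pD R_D[OF pD]]) (use sol_R[OF p] in auto)
    have "Dx H (R p) = HX H p" "Dt H (R p) = HT H p"
      using transfer[OF cH pD] HX_cong[OF base_R_eq[OF H(1)] pD] HT_cong[OF base_R_eq[OF H(1)] pD] by simp_all
    then show ?thesis
      using R[OF FG(1)] R[OF FG(2)] R[OF supported_Dx[OF cH subset_refl shift_valid(2)]]
        R[OF supported_Dt[OF cH subset_refl shift_valid(1)]] H(2,3)[OF pD] by simp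
  qed
  then show ?thesis using cH unfolding trivial_cl_def jet_fun_iff by blast
qed

subsection \<open>Gauge transformations and orders\<close>

text \<open>The relation and its derivative combine to $(\<gamma> + \<delta> u)^2 A(u) = \<delta>\<alpha> - \<beta>\<gamma>$.\<close>

lemma lin_indep:
  assumes 0: "\<And>u. u \<in> I \<Longrightarrow> \<alpha> + \<beta> * u + \<gamma> * IA u + \<delta> * (u * IA u) = 0"
  shows "\<alpha> = 0" "\<beta> = 0" "\<gamma> = 0" "\<delta> = 0"
proof -
  have d: "\<beta> + \<gamma> * A u + \<delta> * (IA u + u * A u) = 0" if "u \<in> I" for u
  proof -
    have "((\<lambda>u. \<alpha> + \<beta> * u + \<gamma> * IA u + \<delta> * (u * IA u)) has_real_derivative
        \<beta> + \<gamma> * A u + \<delta> * (IA u + u * A u)) (at u)"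
      by (auto intro!: derivative_eq_intros IA that simp: algebra_simps)
    moreover have "((\<lambda>u. \<alpha> + \<beta> * u + \<gamma> * IA u + \<delta> * (u * IA u)) has_real_derivative 0) (at u)"
      by (rule has_field_derivative_transform_within_open[OF DERIV_const[of 0] I_open that]) (simp add: 0)
    ultimately show ?thesis by (rule DERIV_unique)
  qed
  have key: "(\<gamma> + \<delta> * u)^2 * A u = \<delta> * \<alpha> - \<beta> * \<gamma>" if "u \<in> I" for u
  proof -
    have "(\<gamma> + \<delta> * u) * (\<beta> + \<gamma> * A u + \<delta> * (IA u + u * A u)) - \<delta> * (\<alpha> + \<beta> * u + \<gamma> * IA u + \<delta> * (u * IA u)) = 0"
      using 0[OF that] d[OF that] by simp
    then show ?thesis by (simp add: algebra_simps power2_eq_square)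
  qed
  obtain u0 where u0: "u0 \<in> I" using I_ne by auto
  show \<delta>: "\<delta> = 0"
  proof (rule ccontr)
    assume \<delta>: "\<delta> \<noteq> 0"
    \<comment> \<open>A zero of \<gamma> + \<delta> u in I would force the constant \<delta>\<alpha>
      - \<beta>\<gamma> to be 0, and then A would vanish at a nearby point.\<close>
    have ne: "\<gamma> + \<delta> * u \<noteq> 0" if u: "u \<in> I" for u
    proof
      assume z: "\<gamma> + \<delta> * u = 0"
      obtain e where e: "e > 0" "ball u e \<subseteq> I" using I_open u openE by blast
      then have m: "u + e / 2 \<in> I" by (auto simp: dist_real_def)
      have "\<gamma> + \<delta> * (u + e / 2) = \<delta> * (e / 2)" using z by (simp add: algebra_simps)
      moreover have "\<delta> * (e / 2) \<noteq> 0" using \<delta> e by simp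
      ultimately have n: "\<gamma> + \<delta> * (u + e / 2) \<noteq> 0" by metis
      have "(\<gamma> + \<delta> * (u + e / 2))^2 * A (u + e / 2) = 0"
        unfolding key[OF m] key[OF u, symmetric] z by simp
      then have "A (u + e / 2) = 0" using n by (simp only: mult_eq_0_iff power_eq_0_iff) simp
      then show False using A_nz[OF m] by simp
    qed
    have "A u = ((\<delta> * \<alpha> - \<beta> * \<gamma>) / \<delta>^2) / (u + \<gamma> / \<delta>)^2" if u: "u \<in> I" for u
    proof -
      have "A u = (\<delta> * \<alpha> - \<beta> * \<gamma>) / (\<gamma> + \<delta> * u)^2" using key[OF u] ne[OF u] by (simp add: field_simps)
      also have "\<gamma> + \<delta> * u = \<delta> * (u + \<gamma> / \<delta>)" using \<delta> by (simp add: field_simps)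
      finally show ?thesis by (simp add: power_mult_distrib)
    qed
    then show False using A_not_frac by blast
  qed
  show \<gamma>: "\<gamma> = 0"
  proof (rule ccontr)
    assume "\<gamma> \<noteq> 0"
    then have "\<forall>u\<in>I. A u = - \<beta> / \<gamma>" using d \<delta> by (auto simp: field_simps eq_neg_iff_add_eq_0)
    then show False using A_not_const by blast
  qed
  show \<beta>: "\<beta> = 0" using d[OF u0] \<gamma> \<delta> by simp
  show "\<alpha> = 0" using 0[OF u0] \<beta> \<gamma> \<delta> by simp
qed

text \<open>The reciprocal of \<phi>'. As \<phi>'' = \<kappa>\<phi>', it solves a linear ODE itself;
  in \<open>triv_linear\<close> it extracts the x-free coefficient of \<phi> from f_x.\<close>

definition \<rho> :: "real \<Rightarrow> real" where "\<rho> x = 1 / (\<kappa> * \<phi> x - \<psi>)"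

lemma \<rho>: "(\<rho> has_real_derivative - \<kappa> * \<rho> x) (at x)"
proof -
  have nz: "\<kappa> * \<phi> x - \<psi> \<noteq> 0" "\<kappa> * \<phi> x \<noteq> \<psi>" "\<psi> \<noteq> \<kappa> * \<phi> x"
    using \<phi>_nz[of x] by auto
  have "((\<lambda>x. 1 / (\<kappa> * \<phi> x - \<psi>)) has_real_derivative - (\<kappa> * (\<kappa> * \<phi> x - \<psi>)) / (\<kappa> * \<phi> x - \<psi>)^2) (at x)"
    by (auto intro!: derivative_eq_intros \<phi> simp: nz power2_eq_square)
  moreover have "- (\<kappa> * (\<kappa> * \<phi> x - \<psi>)) / (\<kappa> * \<phi> x - \<psi>)^2 = - \<kappa> * (1 / (\<kappa> * \<phi> x - \<psi>))"
    using nz(1) by (simp add: power2_eq_square)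
  ultimately show ?thesis by (simp only: \<rho>_def[abs_def])
qed

lemma jet_on_\<rho>: "finite S \<Longrightarrow> X \<in> S \<Longrightarrow> jet_on S (\<lambda>p. \<rho> (p X))"
  by (rule jet_on_ode[of _ "-\<kappa>" 0]) (use \<rho> in auto)

lemma pd_\<rho>: "pd c (\<lambda>p. \<rho> (p X)) p = (if c = X then - \<kappa> * \<rho> (p X) else 0)"
  by (rule has_pd_pd[OF has_pd_fun]) (rule \<rho>)

lemma base_join:
  assumes "base F" "base G" obtains n where "jet_on (B n) F" "jet_on (B n) G"
proof -
  obtain n m where "jet_on (B n) F" "jet_on (B m) G" using assms by (auto simp: base_def)
  then have "jet_on (B (n + m)) F" "jet_on (B (n + m)) G" by (auto elim: jet_on_B_mono)
  then show ?thesis by (rule that)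
qed

lemma base_add: "base F \<Longrightarrow> base G \<Longrightarrow> base (\<lambda>p. F p + G p)"
  by (erule (1) base_join) (rule base_I[OF jet_on_add])
lemma base_mult: "base F \<Longrightarrow> base G \<Longrightarrow> base (\<lambda>p. F p * G p)"
  by (erule (1) base_join) (rule base_I[OF jet_on_mult])
lemma base_diff: "base F \<Longrightarrow> base G \<Longrightarrow> base (\<lambda>p. F p - G p)"
  by (erule (1) base_join) (rule base_I[OF jet_on_diff])
lemma base_const: "base (\<lambda>p. a)"
  by (rule base_I[OF jet_on_const[OF B(1)]])
lemma base_U: "base (\<lambda>p. p (U l))"
  by (rule base_I[OF jet_on_coord[OF B(1), of _ "Suc l"]]) (simp add: B)
lemma base_A: "base (\<lambda>p. A (p (U 0)))"
  by (rule base_I[OF jet_on_A[OF B(1), of 1]]) (simp add: B)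
lemma base_A': "base (\<lambda>p. deriv A (p (U 0)))"
  by (rule base_I[OF jet_on_A'[OF B(1), of 1]]) (simp add: B)
lemma base_IA: "base (\<lambda>p. IA (p (U 0)))"
  by (rule base_I[OF jet_on_IA[OF B(1), of 1]]) (simp add: B)
lemma base_pd: "base F \<Longrightarrow> base (pd c F)"
  unfolding base_def using jet_on_pd by blast
lemma base_pow2: "base F \<Longrightarrow> base (\<lambda>p. (F p)^2)"
  unfolding power2_eq_square by (rule base_mult)

lemmas base_intros = base_add base_mult base_diff base_const base_U base_A base_A' base_IA base_pd base_pow2

lemma base_smooth: "base F \<Longrightarrow> smooth F"
  unfolding base_def using jfD(3) by blast

lemma HX_add: "base F \<Longrightarrow> base G \<Longrightarrow> p \<in> D \<Longrightarrow> HX (\<lambda>p. F p + G p) p = HX F p + HX G p"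
  unfolding HX_def by (erule (1) base_join) (rule der_add)
lemma HX_diff: "base F \<Longrightarrow> base G \<Longrightarrow> p \<in> D \<Longrightarrow> HX (\<lambda>p. F p - G p) p = HX F p - HX G p"
  unfolding HX_def by (erule (1) base_join) (rule der_diff)
lemma HX_mult: "base F \<Longrightarrow> base G \<Longrightarrow> p \<in> D \<Longrightarrow> HX (\<lambda>p. F p * G p) p = HX F p * G p + F p * HX G p"
  unfolding HX_def by (erule (1) base_join) (rule der_mult)
lemma HX_const: "HX (\<lambda>p. a) p = 0"
  by (simp add: HX_def der_const)
lemma HX_U: "HX (\<lambda>p. p (U l)) p = p (U (Suc l))"
  by (simp add: HX_coord bx)
lemma HT_add: "base F \<Longrightarrow> base G \<Longrightarrow> p \<in> D \<Longrightarrow> HT (\<lambda>p. F p + G p) p = HT F p + HT G p"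
  unfolding HT_def by (erule (1) base_join) (rule der_add)
lemma HT_diff: "base F \<Longrightarrow> base G \<Longrightarrow> p \<in> D \<Longrightarrow> HT (\<lambda>p. F p - G p) p = HT F p - HT G p"
  unfolding HT_def by (erule (1) base_join) (rule der_diff)
lemma HT_mult: "base F \<Longrightarrow> base G \<Longrightarrow> p \<in> D \<Longrightarrow> HT (\<lambda>p. F p * G p) p = HT F p * G p + F p * HT G p"
  unfolding HT_def by (erule (1) base_join) (rule der_mult)

lemmas HX_rules = HX_add HX_diff HX_mult HX_const HX_U HX_A HX_IA

text \<open>Conservation law and triviality after pullback: identities on all of D in the free
  coordinates.\<close>

definition law :: "(jpt \<Rightarrow> real) \<Rightarrow> (jpt \<Rightarrow> real) \<Rightarrow> bool" where
  "law F G \<longleftrightarrow> base F \<and> base G \<and> (\<forall>p\<in>D. HT F p + HX G p = 0)"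

definition triv :: "(jpt \<Rightarrow> real) \<Rightarrow> (jpt \<Rightarrow> real) \<Rightarrow> bool" where
  "triv F G \<longleftrightarrow> (\<exists>H. base H \<and> (\<forall>p\<in>D. F p = HX H p \<and> G p = - HT H p))"

text \<open>The added terms cancel because \<open>HX\<close> and \<open>HT\<close> commute.\<close>

lemma gauge_law:
  assumes "law F G" "base H"
  shows "law (\<lambda>p. F p - HX H p) (\<lambda>p. G p + HT H p)"
proof -
  obtain n where n: "jet_on (B n) H" using assms(2) by (auto simp: base_def)
  show ?thesis
    using assms HX_HT[OF n]
    by (auto simp: law_def base_add base_diff base_HX base_HT HX_add HT_diff)
qed

lemma gauge_triv:
  assumes "triv (\<lambda>p. F p - HX H p) (\<lambda>p. G p + HT H p)" "base H"
  shows "triv F G"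
proof -
  obtain H' where H': "base H'" "\<forall>p\<in>D. F p - HX H p = HX H' p \<and> G p + HT H p = - HT H' p"
    using assms(1) by (auto simp: triv_def)
  show ?thesis unfolding triv_def
    by (rule exI[of _ "\<lambda>p. H p + H' p"])
       (use H' assms(2) in \<open>auto simp: base_add HX_add HT_add algebra_simps\<close>)
qed

section \<open>Isolating the highest derivative of u\<close>

lemma sum_B: "(\<Sum>c\<in>B n. h c) = h T + h X + h V1 + h V2 + (\<Sum>l<n. h (U l))" for h :: "coord \<Rightarrow> real"
proof -
  have "(\<Sum>c\<in>B n. h c) = (\<Sum>c\<in>{T, X, V1, V2}. h c) + (\<Sum>c\<in>U ` {..<n}. h c)"
    unfolding B_def by (rule sum.union_disjoint) auto
  also have "(\<Sum>c\<in>U ` {..<n}. h c) = (\<Sum>l<n. h (U l))"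
    by (subst sum.reindex) (auto simp: inj_on_def)
  finally show ?thesis by simp
qed

text \<open>\<open>HX\<close> without the contributions of u_n and higher derivatives. For F of
  order n what is split off is u_{n+1} F_{u_n}, and the rest is free of u_{n+1}, so a law becomes a
  polynomial in its highest derivative.\<close>

definition trunc_x :: "nat \<Rightarrow> (jpt \<Rightarrow> real) \<Rightarrow> jpt \<Rightarrow> real" where
  "trunc_x n F p = pd X F p + p (U 0) * (pd V1 F p + \<phi> (p X) * pd V2 F p) + (\<Sum>l<n. p (U (Suc l)) * pd (U l) F p)"

definition trunc_t :: "nat \<Rightarrow> (jpt \<Rightarrow> real) \<Rightarrow> jpt \<Rightarrow> real" where
  "trunc_t n F p = pd T F p + \<tau>1 p * pd V1 F p + \<tau>2 p * pd V2 F p + (\<Sum>l<n. (HX ^^ l) K p * pd (U l) F p)"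

lemma HX_trunc_x: "jet_on (B n) F \<Longrightarrow> p \<in> D \<Longrightarrow> HX F p = trunc_x n F p"
  using der_expand[OF _ subset_refl B(1), of n F p bx]
  by (simp add: HX_def trunc_x_def sum_B bx algebra_simps)

lemma HT_trunc_t: "jet_on (B n) F \<Longrightarrow> p \<in> D \<Longrightarrow> HT F p = trunc_t n F p"
  using der_expand[OF _ subset_refl B(1), of n F p bt]
  by (simp add: HT_def trunc_t_def sum_B bt)

lemma trunc_x_Suc: "trunc_x (Suc n) F p = trunc_x n F p + p (U (Suc n)) * pd (U n) F p"
  by (simp add: trunc_x_def)

lemma trunc_t_Suc: "trunc_t (Suc n) F p = trunc_t n F p + (HX ^^ n) K p * pd (U n) F p"
  by (simp add: trunc_t_def)

lemma jet_on_trunc_x: "jet_on (B (Suc n)) F \<Longrightarrow> jet_on (B (Suc n)) (trunc_x n F)"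
  unfolding trunc_x_def[abs_def]
  by (intro jet_on_add jet_on_mult jet_on_pd jet_on_sum jet_on_\<phi> jet_on_coord B; simp)

lemma jet_on_trunc_t: "jet_on (B (n + 2)) F \<Longrightarrow> jet_on (B (n + 2)) (trunc_t n F)"
  unfolding trunc_t_def[abs_def]
  by (intro jet_on_add jet_on_mult jet_on_pd jet_on_sum jet_on_\<tau>1 jet_on_\<tau>2 jet_on_B_mono[OF jet_on_K] B; simp)

text \<open>Comparison of coefficients in the variable c by evaluation at 0, 1 and -1; these values
  are available because c is not u itself, whose range is only I.\<close>

lemma poly2:
  assumes "dep S a" "dep S b" "dep S d" and c: "c \<notin> S" "c \<noteq> U 0"
    and eq: "\<And>p. p \<in> D \<Longrightarrow> a p + b p * p c + d p * (p c)^2 = 0" and p: "p \<in> D"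
  shows "a p = 0 \<and> b p = 0 \<and> d p = 0"
proof -
  have D: "p(c := s) \<in> D" for s using p c(2) by (rule upd_D)
  have f: "f (p(c := s)) = f p" if "dep S f" for f s
    by (rule depD[OF that D p]) (use c in auto)
  have "a p + b p * s + d p * s^2 = 0" for s
    using eq[OF D, of s] unfolding f[OF assms(1)] f[OF assms(2)] f[OF assms(3)] by simp
  from this[of 0] this[of 1] this[of "-1"] show ?thesis by simp
qed

lemma poly1:
  assumes "dep S a" "dep S b" and c: "c \<notin> S" "c \<noteq> U 0"
    and eq: "\<And>p. p \<in> D \<Longrightarrow> a p + b p * p c = 0" and p: "p \<in> D"
  shows "a p = 0 \<and> b p = 0"
  using poly2[OF assms(1,2) _ c _ p, of "\<lambda>p. 0"] eq by (simp add: dep_def)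

lemma B_remove: "B (Suc n) - {U n} = B n"
  by (auto simp: B_def lessThan_Suc)

lemma lower_order: "jet_on (B (Suc n)) F \<Longrightarrow> (\<And>p. p \<in> D \<Longrightarrow> pd (U n) F p = 0) \<Longrightarrow> jet_on (B n) F"
  using dep_remove[of "B (Suc n)" F "U n"] by (simp add: B_remove)

text \<open>D_t F has order at most n + 1, so u_{N+1} enters the law only through D_x G, linearly
  and with coefficient G_{u_N}.\<close>

lemma flux_order_aux:
  assumes "law F G" "jet_on (B n) F" "jet_on (B (Suc N)) G" "Suc n \<le> N"
  shows "jet_on (B N) G"
proof (rule lower_order[OF assms(3)])
  fix p assume p: "p \<in> D"
  have "jet_on (B (Suc N)) (\<lambda>p. HT F p + trunc_x N G p)"
    using jet_on_add[OF jet_on_B_mono[OF jet_on_HT[OF assms(2)]] jet_on_trunc_x[OF assms(3)]] assms(4) by simp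
  from poly1[OF jfD(2)[OF this] jfD(2)[OF jet_on_pd[OF assms(3)]], of "U (Suc N)" "U N" p]
  show "pd (U N) G p = 0"
    using assms(1) HX_trunc_x[OF assms(3)] p B(8) by (simp add: law_def trunc_x_Suc algebra_simps)
qed

lemma flux_order:
  assumes "law F G" "jet_on (B n) F"
  shows "jet_on (B (Suc n)) G"
proof -
  obtain M where M: "jet_on (B M) G" using assms by (auto simp: law_def base_def)
  have "jet_on (B M) G \<Longrightarrow> jet_on (B (Suc n)) G" for M
  proof (induction M)
    case (Suc N)
    show ?case
    proof (cases "Suc n \<le> N")
      case True
      then show ?thesis using Suc.IH flux_order_aux[OF assms Suc.prems] by simp
    next
      case False
      then show ?thesis using jet_on_B_mono[OF Suc.prems] by simp
    qed
  qed (erule jet_on_B_mono, simp)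
  then show ?thesis using M by blast
qed

text \<open>Only for n = 0 does $D_x^n K$ contain the square of the derivative of u of order n + 1.\<close>

definition quad :: "nat \<Rightarrow> jpt \<Rightarrow> real" where
  "quad n p = (if n = 0 then deriv A (p (U 0)) else 0)"

lemma jet_on_quad: "jet_on (B (Suc n)) (quad n)"
  unfolding quad_def[abs_def] by (cases "n = 0") (simp_all add: jet_on_A' jet_on_const B)

lemma K_eq: "p \<in> D \<Longrightarrow> K p = A (p (U 0)) * p (U 2) + deriv A (p (U 0)) * (p (U 1))^2 + (\<kappa> * A (p (U 0))) * p (U 1)"
  unfolding K_def \<tau>1_def[abs_def] by (simp add: HX_rules base_intros eval_nat_numeral)

text \<open>In the induction step the old square yields 2 u_{n+1} u_{n+2}, which is linear in
  u_{n+2}, and A u_{n+2} yields A u_{n+3} and A' u_1 u_{n+2}; no square of u_{n+2} can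
  arise.\<close>

lemma K_form: "\<exists>a b. jet_on (B (Suc n)) a \<and> jet_on (B (Suc n)) b \<and>
  (\<forall>p\<in>D. (HX ^^ n) K p = A (p (U 0)) * p (U (n + 2)) + quad n p * (p (U (Suc n)))^2 + a p * p (U (Suc n)) + b p)"
proof (induction n)
  case 0
  have "jet_on (B 1) (\<lambda>p. \<kappa> * A (p (U 0)))" "jet_on (B 1) (\<lambda>p. 0)"
    by (intro jet_on_mult jet_on_const jet_on_A B; simp)+
  then show ?case
    by (rule_tac exI[of _ "\<lambda>p. \<kappa> * A (p (U 0))"], rule_tac exI[of _ "\<lambda>p. 0"])
       (simp add: K_eq quad_def eval_nat_numeral)
next
  case (Suc n)
  then obtain a b where a: "jet_on (B (Suc n)) a" and b: "jet_on (B (Suc n)) b" and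
    K: "\<And>p. p \<in> D \<Longrightarrow> (HX ^^ n) K p = A (p (U 0)) * p (U (n + 2)) + quad n p * (p (U (Suc n)))^2 + a p * p (U (Suc n)) + b p"
    by auto
  define a' where "a' p = deriv A (p (U 0)) * p (U 1) + a p + 2 * (quad n p * p (U (Suc n)))" for p
  define b' where "b' p = p (U (Suc n)) * HX a p + HX b p + (p (U (Suc n)))^2 * HX (quad n) p" for p
  have m: "jet_on (B (Suc n)) F \<Longrightarrow> jet_on (B (Suc (Suc n))) F" for F by (erule jet_on_B_mono) simp
  have "jet_on (B (Suc (Suc n))) a'"
    unfolding a'_def[abs_def] by (intro jet_on_add jet_on_mult jet_on_A' jet_on_coord jet_on_const m[OF a] m[OF jet_on_quad] B) simp_all
  moreover have "jet_on (B (Suc (Suc n))) b'"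
    unfolding b'_def[abs_def] power2_eq_square
    by (intro jet_on_add jet_on_mult jet_on_coord jet_on_HX a b jet_on_quad B) simp_all
  moreover have "(HX ^^ Suc n) K p = A (p (U 0)) * p (U (Suc n + 2)) + quad (Suc n) p * (p (U (Suc (Suc n))))^2
      + a' p * p (U (Suc (Suc n))) + b' p" if p: "p \<in> D" for p
  proof -
    have "(HX ^^ Suc n) K p = HX (\<lambda>p. A (p (U 0)) * p (U (n + 2)) + quad n p * (p (U (Suc n)))^2 + a p * p (U (Suc n)) + b p) p"
      using HX_cong[OF K p] by simp
    also have "\<dots> = A (p (U 0)) * p (U (Suc n + 2)) + quad (Suc n) p * (p (U (Suc (Suc n))))^2
      + a' p * p (U (Suc (Suc n))) + b' p"
      using p base_I[OF a] base_I[OF b] base_I[OF jet_on_quad[of n]] unfolding power2_eq_square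
      by (simp add: HX_rules base_intros a'_def b'_def quad_def[of "Suc n"] algebra_simps power2_eq_square)
    finally show ?thesis .
  qed
  ultimately show ?case by blast
qed

subsection \<open>Reduction of the order\<close>

text \<open>The coefficient of u_{n+2} in the law: D_t F contributes A F_{u_n} through D_x^n K, and
  D_x G contributes G_{u_{n+1}}.\<close>

lemma flux_top:
  assumes l: "law F G" and F: "jet_on (B (Suc n)) F" and p: "p \<in> D"
  shows "pd (U (Suc n)) G p = - (A (p (U 0)) * pd (U n) F p)"
proof -
  have G: "jet_on (B (Suc (Suc n))) G" by (rule flux_order[OF l F])
  obtain a b where a: "jet_on (B (Suc n)) a" and b: "jet_on (B (Suc n)) b" and
    K: "\<And>p. p \<in> D \<Longrightarrow> (HX ^^ n) K p = A (p (U 0)) * p (U (n + 2)) + quad n p * (p (U (Suc n)))^2 + a p * p (U (Suc n)) + b p"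
    using K_form[of n] by auto
  have m: "jet_on (B (Suc n)) F \<Longrightarrow> jet_on (B (Suc (Suc n))) F" for F by (erule jet_on_B_mono) simp
  \<comment> \<open>Everything in the law that is free of u_{n+2}.\<close>
  define r where "r = (\<lambda>p. trunc_t n F p + (quad n p * (p (U (Suc n)) * p (U (Suc n))) + a p * p (U (Suc n)) + b p) * pd (U n) F p + trunc_x (Suc n) G p)"
  have "jet_on (B (n + 2)) (trunc_t n F)" by (rule jet_on_trunc_t) (use m[OF F] in simp)
  then have jr: "jet_on (B (Suc (Suc n))) r" unfolding r_def
    by (intro jet_on_add jet_on_mult jet_on_pd jet_on_coord m[OF jet_on_quad] m[OF a] m[OF b] m[OF F] jet_on_trunc_x G B) simp_all
  have jt: "jet_on (B (Suc (Suc n))) (\<lambda>p. A (p (U 0)) * pd (U n) F p + pd (U (Suc n)) G p)"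
    by (intro jet_on_add jet_on_mult jet_on_A jet_on_pd m[OF F] G B) simp_all
  have "r p + (A (p (U 0)) * pd (U n) F p + pd (U (Suc n)) G p) * p (U (Suc (Suc n))) = 0" if "p \<in> D" for p
  proof -
    have "HT F p + HX G p = 0" using l that by (simp add: law_def)
    then show ?thesis
      unfolding HT_trunc_t[OF F that] trunc_t_Suc HX_trunc_x[OF G that] trunc_x_Suc[of "Suc n"] K[OF that] r_def
      by (simp add: power2_eq_square algebra_simps)
  qed
  from poly1[OF jfD(2)[OF jr] jfD(2)[OF jt] _ _ this p]
  show ?thesis by (simp add: B(8) add_eq_0_iff)
qed

text \<open>By \<open>flux_top\<close> the added term cancels the dependence of G on u_{n+1}, since
  A F_{u_n} does not contain that coordinate.\<close>

lemma flux_split: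
  assumes l: "law F G" and F: "jet_on (B (Suc n)) F"
  shows "jet_on (B (Suc n)) (\<lambda>p. G p + A (p (U 0)) * pd (U n) F p * p (U (Suc n)))"
proof (rule lower_order)
  have G: "jet_on (B (Suc (Suc n))) G" by (rule flux_order[OF l F])
  have M: "jet_on (B (Suc n)) (\<lambda>p. A (p (U 0)) * pd (U n) F p)"
    by (intro jet_on_mult jet_on_A jet_on_pd F B) simp_all
  have M': "jet_on (B (Suc (Suc n))) (\<lambda>p. A (p (U 0)) * pd (U n) F p)" by (rule jet_on_B_mono[OF M]) simp
  have c: "jet_on (B (Suc (Suc n))) (\<lambda>p. p (U (Suc n)))" by (intro jet_on_coord B) simp
  show "jet_on (B (Suc (Suc n))) (\<lambda>p. G p + A (p (U 0)) * pd (U n) F p * p (U (Suc n)))"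
    by (rule jet_on_add[OF G jet_on_mult[OF M' c]])
  fix p assume p: "p \<in> D"
  have "pd (U (Suc n)) (\<lambda>p. G p + A (p (U 0)) * pd (U n) F p * p (U (Suc n))) p =
     pd (U (Suc n)) G p + (pd (U (Suc n)) (\<lambda>p. A (p (U 0)) * pd (U n) F p) p * p (U (Suc n)) + A (p (U 0)) * pd (U n) F p)"
    using pd_add[OF jfD(3)[OF G] jfD(3)[OF jet_on_mult[OF M' c]] p] pd_mult[OF jfD(3)[OF M'] jfD(3)[OF c] p]
    by (simp add: pd_coord)
  then show "pd (U (Suc n)) (\<lambda>p. G p + A (p (U 0)) * pd (U n) F p * p (U (Suc n))) p = 0"
    using flux_top[OF l F p] pd_outside[OF M _ p, of "U (Suc n)"] by (simp add: B(8))
qed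

text \<open>The term of the law quadratic in the derivative of u of order n + 1 is $-A F_{u_n u_n}$.\<close>

lemma density_affine:
  assumes l: "law F G" and F: "jet_on (B (Suc n)) F" and p: "p \<in> D"
  shows "pd (U n) (pd (U n) F) p = 0"
proof -
  define M where "M = (\<lambda>p. A (p (U 0)) * pd (U n) F p)"
  define G0 where "G0 = (\<lambda>p. G p + M p * p (U (Suc n)))"
  have M: "jet_on (B (Suc n)) M" unfolding M_def by (intro jet_on_mult jet_on_A jet_on_pd F B) simp_all
  have G0: "jet_on (B (Suc n)) G0" unfolding G0_def M_def by (rule flux_split[OF l F])
  obtain a b where a: "jet_on (B (Suc n)) a" and b: "jet_on (B (Suc n)) b" and
    K: "\<And>p. p \<in> D \<Longrightarrow> (HX ^^ n) K p = A (p (U 0)) * p (U (n + 2)) + quad n p * (p (U (Suc n)))^2 + a p * p (U (Suc n)) + b p"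
    using K_form[of n] by auto
  \<comment> \<open>This part of D_t F is affine in u_{n+1}: for n = 0 through \<tau>1 and \<tau>2,
    otherwise through D_x^{n-1} K, whose leading term is A u_{n+1}.\<close>
  obtain P Q where P: "jet_on (B (Suc n)) P" and Q: "jet_on (B (Suc n)) Q" and
    PQ: "\<And>p. p \<in> D \<Longrightarrow> trunc_t n F p = P p + Q p * p (U (Suc n))"
  proof (cases n)
    case 0
    show ?thesis
    proof
      show "jet_on (B (Suc n)) (\<lambda>p. pd T F p + \<kappa> * IA (p (U 0)) * pd V1 F p + \<psi> * IA (p (U 0)) * pd V2 F p)"
        "jet_on (B (Suc n)) (\<lambda>p. A (p (U 0)) * (pd V1 F p + \<phi> (p X) * pd V2 F p))"
        by (intro jet_on_add jet_on_mult jet_on_pd jet_on_IA jet_on_A jet_on_\<phi> jet_on_const F B; simp)+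
    qed (simp add: 0 trunc_t_def \<tau>1_def \<tau>2_def algebra_simps)
  next
    case (Suc m)
    obtain a b where a: "jet_on (B (Suc m)) a" and b: "jet_on (B (Suc m)) b" and
      K: "\<And>p. p \<in> D \<Longrightarrow> (HX ^^ m) K p = A (p (U 0)) * p (U (m + 2)) + quad m p * (p (U (Suc m)))^2 + a p * p (U (Suc m)) + b p"
      using K_form[of m] by auto
    have m: "jet_on (B (Suc m)) f \<Longrightarrow> jet_on (B (Suc n)) f" for f by (erule jet_on_B_mono) (simp add: Suc)
    have "jet_on (B (m + 2)) (trunc_t m F)" by (rule jet_on_trunc_t) (use F Suc in simp)
    then have L: "jet_on (B (Suc n)) (trunc_t m F)" using Suc by simp
    show ?thesis
    proof
      show "jet_on (B (Suc n)) (\<lambda>p. trunc_t m F p + (quad m p * (p (U n) * p (U n)) + a p * p (U n) + b p) * pd (U m) F p)"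
        "jet_on (B (Suc n)) (\<lambda>p. A (p (U 0)) * pd (U m) F p)"
        by (intro jet_on_add jet_on_mult jet_on_pd L jet_on_A m[OF a] m[OF b] m[OF jet_on_quad] jet_on_coord F B; simp)+
    qed (simp add: Suc trunc_t_Suc K power2_eq_square algebra_simps)
  qed
  have cf: "\<And>p. p \<in> D \<Longrightarrow> HX G p = HX G0 p - (HX M p * p (U (Suc n)) + M p * p (U (Suc (Suc n))))"
  proof -
    fix p assume p: "p \<in> D"
    have "HX G p = HX (\<lambda>p. G0 p - M p * p (U (Suc n))) p"
      by (rule HX_cong[OF _ p]) (simp add: G0_def)
    then show "HX G p = HX G0 p - (HX M p * p (U (Suc n)) + M p * p (U (Suc (Suc n))))"
      using p base_I[OF G0] base_I[OF M] by (simp add: HX_rules base_intros)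
  qed
  \<comment> \<open>The coefficients of the powers of u_{n+1} in the law; the terms in u_{n+2} have
    cancelled by the choice of M.\<close>
  define c0 where "c0 = (\<lambda>p. P p + b p * pd (U n) F p + trunc_x n G0 p)"
  define c1 where "c1 = (\<lambda>p. Q p + a p * pd (U n) F p + pd (U n) G0 p - trunc_x n M p)"
  define c2 where "c2 = (\<lambda>p. quad n p * pd (U n) F p - pd (U n) M p)"
  have j: "jet_on (B (Suc n)) c0" "jet_on (B (Suc n)) c1" "jet_on (B (Suc n)) c2"
    unfolding c0_def c1_def c2_def
    by (intro jet_on_add jet_on_mult jet_on_diff jet_on_pd jet_on_quad jet_on_trunc_x P Q a b F G0 M)+
  have "c0 p + c1 p * p (U (Suc n)) + c2 p * (p (U (Suc n)))^2 = 0" if "p \<in> D" for p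
  proof -
    have "HT F p + HX G p = 0" using l that by (simp add: law_def)
    then show ?thesis
      unfolding HT_trunc_t[OF F that] trunc_t_Suc cf[OF that] HX_trunc_x[OF G0 that] HX_trunc_x[OF M that] trunc_x_Suc K[OF that] PQ[OF that]
        c0_def c1_def c2_def
      by (simp add: M_def power2_eq_square algebra_simps)
  qed
  from poly2[OF j[THEN jfD(2)] _ _ this p] have "c2 p = 0" by (simp add: B(8))
  \<comment> \<open>For n = 0 the square in K cancels against the derivative of the factor A in M,
    so affinity in u_n holds at order zero too.\<close>
  moreover have "pd (U n) M p = quad n p * pd (U n) F p + A (p (U 0)) * pd (U n) (pd (U n) F) p"
    unfolding M_def
    using pd_mult[OF base_smooth[OF base_A] jfD(3)[OF jet_on_pd[OF F]] p] pd_A[OF p]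
    by (auto simp: quad_def)
  ultimately show ?thesis using A_nz p by (simp add: c2_def in_D)
qed

lemma density_split:
  assumes l: "law F G" and F: "jet_on (B (Suc n)) F"
  shows "jet_on (B n) (pd (U n) F)" "jet_on (B n) (\<lambda>p. F p - p (U n) * pd (U n) F p)"
proof -
  show 1: "jet_on (B n) (pd (U n) F)"
    by (rule lower_order[OF jet_on_pd[OF F] density_affine[OF l F]])
  have c: "jet_on (B (Suc n)) (\<lambda>p. p (U n))" by (intro jet_on_coord B) simp
  show "jet_on (B n) (\<lambda>p. F p - p (U n) * pd (U n) F p)"
  proof (rule lower_order)
    show "jet_on (B (Suc n)) (\<lambda>p. F p - p (U n) * pd (U n) F p)"
      by (intro jet_on_diff jet_on_mult jet_on_pd F c)
    fix p assume p: "p \<in> D"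
    have "pd (U n) (\<lambda>p. F p + (- p (U n)) * pd (U n) F p) p = pd (U n) F p + pd (U n) (\<lambda>p. (- p (U n)) * pd (U n) F p) p"
      by (rule pd_add[OF jfD(3)[OF F] jfD(3)[OF jet_on_mult[OF jet_on_minus[OF c] jet_on_pd[OF F]]] p])
    also have "pd (U n) (\<lambda>p. (- p (U n)) * pd (U n) F p) p =
       pd (U n) (\<lambda>p. - p (U n)) p * pd (U n) F p + (- p (U n)) * pd (U n) (pd (U n) F) p"
      by (rule pd_mult[OF jfD(3)[OF jet_on_minus[OF c]] jfD(3)[OF jet_on_pd[OF F]] p])
    also have "pd (U n) (\<lambda>p. - p (U n)) p = -1"
      using pd_mult[OF jfD(3)[OF jet_on_const[OF B(1), of _ "-1"]] jfD(3)[OF c] p, of "U n"]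
      by (simp add: pd_const pd_coord)
    finally show "pd (U n) (\<lambda>p. F p - p (U n) * pd (U n) F p) p = 0"
      using density_affine[OF l F p] by simp
  qed
qed

lemma coord_range_ne: "\<exists>a. a \<in> coord_range c"
  using I_ne by (auto simp: coord_range_def)

lemma zero_coord_range: "c \<noteq> U 0 \<Longrightarrow> 0 \<in> coord_range c"
  by (simp add: coord_range_def)

lemma reduce_order:
  assumes l: "law F G" and F: "jet_on (B (Suc (Suc n))) F"
  obtains H where "base H" "jet_on (B (Suc n)) (\<lambda>p. F p - HX H p)"
proof -
  \<comment> \<open>For n = 0 the base point of the primitive has to lie in I, which may not contain
    0.\<close>
  obtain a where a: "a \<in> coord_range (U n)" using coord_range_ne by blast
  define F1 where "F1 = pd (U (Suc n)) F"
  define H where "H = prim (U n) a F1"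
  have s: "jet_on (B (Suc n)) F1" "jet_on (B (Suc n)) (\<lambda>p. F p - p (U (Suc n)) * F1 p)"
    unfolding F1_def by (rule density_split[OF l F])+
  have H: "jet_on (B (Suc n)) H" unfolding H_def by (rule jet_on_prim[OF s(1) a]) (simp add: B)
  have "jet_on (B (Suc n)) (\<lambda>p. F p - p (U (Suc n)) * F1 p - trunc_x n H p)"
    by (rule jet_on_diff[OF s(2) jet_on_trunc_x[OF H]])
  then have "jet_on (B (Suc n)) (\<lambda>p. F p - HX H p)"
  proof (rule jet_on_cong)
    fix p assume p: "p \<in> D"
    have "pd (U n) H p = F1 p" unfolding H_def by (rule pd_prim_same[OF s(1) a p])
    then show "F p - p (U (Suc n)) * F1 p - trunc_x n H p = F p - HX H p"
      using HX_trunc_x[OF H p] by (simp add: trunc_x_Suc)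
  qed
  then show ?thesis using that base_I[OF H] by blast
qed

subsection \<open>Conservation laws of order zero\<close>

lemma prim_cong:
  assumes "\<And>p. p \<in> D \<Longrightarrow> f p = g p" "p \<in> D" "a \<in> coord_range c"
  shows "prim c a f p = prim c a g p"
  unfolding prim_def by (rule integral_cong) (use assms seg_D in simp)

lemma prim_0: "(\<And>p. p \<in> D \<Longrightarrow> f p = 0) \<Longrightarrow> p \<in> D \<Longrightarrow> a \<in> coord_range c \<Longrightarrow> prim c a f p = 0"
  using prim_cong[of f "\<lambda>p. 0" p a c] by (simp add: prim_def)

lemma base_\<phi>: "base (\<lambda>p. \<phi> (p X))"
  by (rule base_I[OF jet_on_\<phi>[OF B(1) B(3), of 0]])
lemma base_\<rho>: "base (\<lambda>p. \<rho> (p X))"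
  by (rule base_I[OF jet_on_\<rho>[OF B(1) B(3), of 0]])

lemma pd_add': "base F \<Longrightarrow> base G \<Longrightarrow> p \<in> D \<Longrightarrow> pd c (\<lambda>p. F p + G p) p = pd c F p + pd c G p"
  by (rule pd_add[OF base_smooth base_smooth])
lemma pd_mult': "base F \<Longrightarrow> base G \<Longrightarrow> p \<in> D \<Longrightarrow> pd c (\<lambda>p. F p * G p) p = pd c F p * G p + F p * pd c G p"
  by (rule pd_mult[OF base_smooth base_smooth])
lemma pd_minus': "base F \<Longrightarrow> p \<in> D \<Longrightarrow> pd c (\<lambda>p. - F p) p = - pd c F p"
  using pd_mult'[OF base_const[of "-1"], of F p c] by (simp add: pd_const)
lemma pd_diff': "base F \<Longrightarrow> base G \<Longrightarrow> p \<in> D \<Longrightarrow> pd c (\<lambda>p. F p - G p) p = pd c F p - pd c G p"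
  using pd_add'[of F "\<lambda>p. - G p" p c] pd_minus'[of G p c] base_diff[OF base_const[of 0], of G] by simp

lemmas pd_rules = pd_add' pd_diff' pd_mult' pd_const pd_coord pd_A pd_IA pd_\<phi> pd_\<rho>

text \<open>The coefficients do not involve u, so u can be varied over I with all else
  fixed.\<close>

lemma lin_indep_B0:
  assumes j: "dep (B 0) a" "dep (B 0) b" "dep (B 0) c" "dep (B 0) d"
    and eq: "\<And>p. p \<in> D \<Longrightarrow> a p + b p * p (U 0) + c p * IA (p (U 0)) + d p * (p (U 0) * IA (p (U 0))) = 0"
    and p: "p \<in> D"
  shows "a p = 0" "b p = 0" "c p = 0" "d p = 0"
proof -
  have *: "a p + b p * u + c p * IA u + d p * (u * IA u) = 0" if "u \<in> I" for u
  proof -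
    have D: "p(U 0 := u) \<in> D" using that by (simp add: in_D)
    have f: "f (p(U 0 := u)) = f p" if "dep (B 0) f" for f
      by (rule depD[OF that D p]) (auto simp: B_def)
    show ?thesis using eq[OF D] unfolding f[OF j(1)] f[OF j(2)] f[OF j(3)] f[OF j(4)] by simp
  qed
  show "a p = 0" "b p = 0" "c p = 0" "d p = 0" using lin_indep[OF *] by auto
qed

text \<open>The highest derivative of u in D_x G appears linearly, which strips G of u and all its
  derivatives. The coefficients of 1 and u then give G_x = 0 and G_{v^1} + \<phi> G_{v^2} = 0, and
  the latter splits at two values of x where \<phi> differs.\<close>

lemma kernel_HX:
  assumes G: "base G" "\<And>p. p \<in> D \<Longrightarrow> HX G p = 0"
  shows "jet_on (B 0) G" "p \<in> D \<Longrightarrow> pd X G p = 0" "p \<in> D \<Longrightarrow> pd V1 G p = 0" "p \<in> D \<Longrightarrow> pd V2 G p = 0"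
proof -
  have "jet_on (B N) G \<Longrightarrow> jet_on (B 0) G" for N
  proof (induction N)
    case (Suc N)
    have "jet_on (B N) G"
    proof (rule lower_order[OF Suc.prems])
      fix p assume p: "p \<in> D"
      show "pd (U N) G p = 0"
        using poly1[OF jfD(2)[OF jet_on_trunc_x[OF Suc.prems]] jfD(2)[OF jet_on_pd[OF Suc.prems]], of "U (Suc N)" "U N" p]
          G(2) HX_trunc_x[OF Suc.prems] p B(8) by (simp add: trunc_x_Suc mult.commute)
    qed
    then show ?case by (rule Suc.IH)
  qed
  then show G0: "jet_on (B 0) G" using G(1) by (auto simp: base_def)
  have jw: "jet_on (B 0) (\<lambda>p. pd V1 G p + \<phi> (p X) * pd V2 G p)"
    by (intro jet_on_add jet_on_mult jet_on_pd G0 jet_on_\<phi> B)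
  have z: "dep (B 0) (\<lambda>p. 0)" by (simp add: dep_def)
  have eq: "pd X G p + (pd V1 G p + \<phi> (p X) * pd V2 G p) * p (U 0) + 0 * IA (p (U 0)) + 0 * (p (U 0) * IA (p (U 0))) = 0"
    if "p \<in> D" for p
    using G(2)[OF that] HX_trunc_x[OF G0 that] by (simp add: trunc_x_def mult.commute)
  note l = lin_indep_B0[OF jfD(2)[OF jet_on_pd[OF G0]] jfD(2)[OF jw] z z eq]
  show X: "pd X G p = 0" if "p \<in> D" for p using l(1)[OF _ that] by simp
  have 12: "pd V1 G p + \<phi> (p X) * pd V2 G p = 0" if "p \<in> D" for p using l(2)[OF _ that] by simp
  have nX: "jet_on (B 0 - {X}) G" by (rule dep_remove[OF G0 X])
  have V2: "pd V2 G p = 0" if p: "p \<in> D" for p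
  proof -
    obtain x where x: "\<phi> x \<noteq> \<phi> (p X)"
    proof (rule ccontr)
      assume "\<not> thesis"
      then have "\<phi> x = \<phi> (p X)" for x using that by blast
      then have "\<phi> = (\<lambda>x. \<phi> (p X))" by (simp add: fun_eq_iff)
      then have "(\<phi> has_real_derivative 0) (at (p X))" by (metis DERIV_const)
      then show False using DERIV_unique[OF \<phi>] \<phi>_nz by metis
    qed
    have D: "p(X := x) \<in> D" using p by (simp add: in_D)
    have f: "pd c G (p(X := x)) = pd c G p" for c
      by (rule depD[OF jfD(2)[OF jet_on_pd[OF nX]] D p]) auto
    have "(\<phi> x - \<phi> (p X)) * pd V2 G p = 0"
      using 12[OF D] 12[OF p] unfolding f left_diff_distrib fun_upd_same by linarith
    then show ?thesis using x by simp
  qed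
  then show "p \<in> D \<Longrightarrow> pd V2 G p = 0" for p .
  show "pd V1 G p = 0" if "p \<in> D" for p using 12[OF that] V2[OF that] by simp
qed

text \<open>D_x G = 0 leaves a function of t alone, and its antiderivative in t with the sign
  reversed is the potential.\<close>

lemma triv_zero:
  assumes l: "law F G" and F: "\<And>p. p \<in> D \<Longrightarrow> F p = 0"
  shows "triv F G"
proof -
  have G: "base G" "HX G p = 0" if "p \<in> D" for p
    using l HT_0[OF F that] that by (auto simp: law_def)
  have bG: "base G" using l by (simp add: law_def)
  note k = kernel_HX[OF bG G(2)]
  have m: "jet_on (B 0) (\<lambda>p. - G p)" by (rule jet_on_minus[OF k(1)])
  define H where "H = prim T 0 (\<lambda>p. - G p)"
  have z: "0 \<in> coord_range T" by (simp add: zero_coord_range)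
  have H: "jet_on (B 0) H" unfolding H_def by (rule jet_on_prim[OF m z]) (simp add: B)
  have "pd c H p = 0" if "p \<in> D" "c \<in> {X, V1, V2}" for c p
  proof -
    have "pd c H p = prim T 0 (pd c (\<lambda>p. - G p)) p"
      unfolding H_def by (rule pd_prim_other[OF m z that(1)]) (use that(2) in auto)
    also have "\<dots> = 0"
      by (rule prim_0[OF _ that(1) z]) (use that(2) k pd_minus'[OF bG] in auto)
    finally show ?thesis .
  qed
  moreover have "pd T H p = - G p" if "p \<in> D" for p
    unfolding H_def by (rule pd_prim_same[OF m z that])
  ultimately have "HX H p = 0 \<and> HT H p = - G p" if "p \<in> D" for p
    using HX_trunc_x[OF H that] HT_trunc_t[OF H that] that by (simp add: trunc_x_def trunc_t_def)
  then show ?thesis unfolding triv_def using base_I[OF H] F by (intro exI[of _ H]) simp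
qed

text \<open>Supplies the initial values on v^2 = 0 for the integration in
  \<open>potential\<close>.\<close>

lemma slice:
  assumes "jet_on (B 0) b"
  shows "jet_on (B 0) (\<lambda>p. b (p(V2 := 0)))" "c \<noteq> V2 \<Longrightarrow> pd c (\<lambda>p. b (p(V2 := 0))) p = pd c b (p(V2 := 0))"
    "pd V2 (\<lambda>p. b (p(V2 := 0))) p = 0"
proof -
  have c: "(\<lambda>p. (p(V2 := 0)) c) = (if c = V2 then (\<lambda>p. 0) else (\<lambda>p. p c))" for c
    by (auto simp: fun_eq_iff)
  show "jet_on (B 0) (\<lambda>p. b (p(V2 := 0)))"
  proof (rule jet_on_comp[OF assms])
    show "smooth (\<lambda>p. (p(V2 := 0)) c)" for c
      unfolding c by (auto simp: smooth_def smooth_upto_const smooth_upto_coord)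
    show "jet_on (B 0) (\<lambda>p. (p(V2 := 0)) c)" if "c \<in> B 0" for c
      unfolding c using that by (auto intro: jet_on_const jet_on_coord B)
  qed (auto simp: in_D B)
  show "c \<noteq> V2 \<Longrightarrow> pd c (\<lambda>p. b (p(V2 := 0))) p = pd c b (p(V2 := 0))"
    by (simp add: pd_def fun_upd_twist)
  show "pd V2 (\<lambda>p. b (p(V2 := 0))) p = 0" by (simp add: pd_def)
qed

text \<open>The Poincare lemma for b dv^1 + a dv^2 with t as a parameter: integrate b along the line
  v^2 = 0 and then a in the direction of v^2.\<close>

lemma potential:
  assumes a: "jet_on (B 0) a" and b: "jet_on (B 0) b"
    and X: "\<And>p. p \<in> D \<Longrightarrow> pd X a p = 0" "\<And>p. p \<in> D \<Longrightarrow> pd X b p = 0"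
    and closed: "\<And>p. p \<in> D \<Longrightarrow> pd V1 a p = pd V2 b p"
  obtains H where "jet_on (B 0) H" "\<And>p. p \<in> D \<Longrightarrow> pd X H p = 0"
    "\<And>p. p \<in> D \<Longrightarrow> pd V1 H p = b p" "\<And>p. p \<in> D \<Longrightarrow> pd V2 H p = a p"
proof -
  define b0 where "b0 = (\<lambda>p. b (p(V2 := 0)))"
  have b0: "jet_on (B 0) b0" unfolding b0_def by (rule slice[OF b])
  have z: "0 \<in> coord_range V1" "0 \<in> coord_range V2" by (simp_all add: zero_coord_range)
  have j: "jet_on (B 0) (prim V2 0 a)" "jet_on (B 0) (prim V1 0 b0)"
    by (rule jet_on_prim[OF a z(2)] jet_on_prim[OF b0 z(1)], simp add: B)+
  define H where "H = (\<lambda>p. prim V2 0 a p + prim V1 0 b0 p)"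
  have H: "jet_on (B 0) H" unfolding H_def by (rule jet_on_add[OF j])
  have pdH: "pd c H p = pd c (prim V2 0 a) p + pd c (prim V1 0 b0) p" if "p \<in> D" for c p
    unfolding H_def by (rule pd_add[OF jfD(3)[OF j(1)] jfD(3)[OF j(2)] that])
  have D0: "p(V2 := 0) \<in> D" if "p \<in> D" for p using that by (simp add: in_D)
  show ?thesis
  proof (rule that[OF H])
    fix p assume p: "p \<in> D"
    have "prim V1 0 (pd X b0) p = 0"
      by (rule prim_0[OF _ p z(1)]) (simp add: b0_def slice[OF b] X D0)
    then show "pd X H p = 0"
      using pdH[OF p] pd_prim_other[OF a z(2) p, of X] pd_prim_other[OF b0 z(1) p, of X]
        prim_0[OF X(1) p z(2)] by simp
    have "prim V2 0 (pd V1 a) p = prim V2 0 (pd V2 b) p"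
      by (rule prim_cong[OF closed p z(2)])
    also have "\<dots> = b p - b0 p"
      unfolding b0_def by (rule prim_pd_self[OF smooth_has_pd[OF jfD(3)[OF b]] z(2) p])
    finally show "pd V1 H p = b p"
      using pdH[OF p] pd_prim_other[OF a z(2) p, of V1] pd_prim_same[OF b0 z(1) p] by simp
    have "prim V1 0 (pd V2 b0) p = 0"
      by (rule prim_0[OF _ p z(1)]) (simp add: b0_def slice[OF b])
    then show "pd V2 H p = a p"
      using pdH[OF p] pd_prim_same[OF a z(2) p] pd_prim_other[OF b0 z(1) p, of V2] by simp
  qed
qed

text \<open>The law is compared first in powers of u_1 and then in 1, u, \<integral>A,
  u\<integral>A. The resulting equations for f give an H that reproduces the density, and
  \<open>triv_zero\<close> treats the remaining flux.\<close>

lemma triv_linear: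
  assumes l: "law F G" and f: "jet_on (B 0) f" and Ff: "\<And>p. p \<in> D \<Longrightarrow> F p = p (U 0) * f p"
  shows "triv F G"
proof -
  have bf: "base f" by (rule base_I[OF f])
  have f1: "jet_on (B (Suc 0)) f" by (rule jet_on_B_mono[OF f]) simp
  have "jet_on (B (Suc 0)) (\<lambda>p. p (U 0) * f p)" by (intro jet_on_mult jet_on_coord f1 B) simp
  then have F: "jet_on (B (Suc 0)) F" by (rule jet_on_cong) (simp add: Ff)
  have FU: "pd (U 0) F p = f p" if "p \<in> D" for p
    using pd_cong[of F "\<lambda>p. p (U 0) * f p" p "U 0", OF Ff that] that pd_outside[OF f, of "U 0" p]
    by (simp add: pd_rules base_intros bf B(8))
  define M where "M = (\<lambda>p. A (p (U 0)) * f p)"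
  define G0 where "G0 = (\<lambda>p. G p + M p * p (U 1))"
  have bM: "base M" unfolding M_def by (intro base_intros bf)
  have G0: "jet_on (B (Suc 0)) G0"
    by (rule jet_on_cong[OF flux_split[OF l F]]) (simp add: FU G0_def M_def)
  have HXf: "HX f p = pd X f p + p (U 0) * (pd V1 f p + \<phi> (p X) * pd V2 f p)" if "p \<in> D" for p
    using HX_trunc_x[OF f that] by (simp add: trunc_x_def)
  have HTf: "HT f p = pd T f p + \<tau>1 p * pd V1 f p + \<tau>2 p * pd V2 f p" if "p \<in> D" for p
    using HT_trunc_t[OF f that] by (simp add: trunc_t_def)
  have HTF: "HT F p = K p * f p + p (U 0) * HT f p" if "p \<in> D" for p
    using HT_cong[OF Ff that] HT_mult[OF base_U bf that, of 0] by (simp add: HT_coord bt)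
  have HXG: "HX G p = HX G0 p - ((deriv A (p (U 0)) * p (U 1) * f p + A (p (U 0)) * HX f p) * p (U 1) + M p * p (U 2))"
    if "p \<in> D" for p
  proof -
    have "HX G p = HX (\<lambda>p. G0 p - M p * p (U 1)) p"
      by (rule HX_cong[OF _ that]) (simp add: G0_def)
    also have "\<dots> = HX G0 p - (HX M p * p (U 1) + M p * p (U 2))"
      using that base_I[OF G0] bM by (simp add: HX_rules base_intros eval_nat_numeral)
    also have "HX M p = deriv A (p (U 0)) * p (U 1) * f p + A (p (U 0)) * HX f p"
      unfolding M_def using that bf by (simp add: HX_rules base_intros)
    finally show ?thesis .
  qed
  \<comment> \<open>The terms in u_2 and u_1^2 cancel between D_t F and D_x G, as do those in u_1
    with v-derivatives of f; what remains is c0 + c1 u_1.\<close>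
  define c0 where "c0 = (\<lambda>p. p (U 0) * (pd T f p + \<kappa> * IA (p (U 0)) * pd V1 f p + \<psi> * IA (p (U 0)) * pd V2 f p) + trunc_x 0 G0 p)"
  define c1 where "c1 = (\<lambda>p. \<kappa> * A (p (U 0)) * f p - A (p (U 0)) * pd X f p + pd (U 0) G0 p)"
  have j: "jet_on (B (Suc 0)) c0" "jet_on (B (Suc 0)) c1"
    unfolding c0_def c1_def
    by (intro jet_on_add jet_on_diff jet_on_mult jet_on_const jet_on_A jet_on_IA jet_on_coord jet_on_pd f1 G0 jet_on_trunc_x B; simp)+
  have c01: "c0 p + c1 p * p (U (Suc 0)) = 0" if "p \<in> D" for p
  proof -
    have "HT F p + HX G p = 0" using l that by (simp add: law_def)
    then show ?thesis
      unfolding HTF[OF that] HXG[OF that] HXf[OF that] HTf[OF that] K_eq[OF that] HX_trunc_x[OF G0 that] trunc_x_Suc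
        M_def c0_def c1_def \<tau>1_def \<tau>2_def
      by (simp add: power2_eq_square algebra_simps)
  qed
  have c0z: "c0 p = 0" and c1z: "c1 p = 0" if "p \<in> D" for p
    using poly1[OF j[THEN jfD(2)] _ _ c01 that] by (simp_all add: B(8))
  \<comment> \<open>c1 = 0 says that the u-derivative of G0 is A h, so G0 is h\<integral>A up to a
    function k free of u.\<close>
  define h where "h = (\<lambda>p. pd X f p - \<kappa> * f p)"
  have h: "jet_on (B 0) h" unfolding h_def by (intro jet_on_diff jet_on_mult jet_on_const jet_on_pd f B)
  have bh: "base h" by (rule base_I[OF h])
  have h1: "jet_on (B (Suc 0)) h" by (rule jet_on_B_mono[OF h]) simp
  define k where "k = (\<lambda>p. G0 p - IA (p (U 0)) * h p)"
  have bG0: "base G0" by (rule base_I[OF G0])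
  have k: "jet_on (B 0) k"
  proof (rule lower_order)
    show "jet_on (B (Suc 0)) k" unfolding k_def by (intro jet_on_diff jet_on_mult jet_on_IA G0 h1 B) simp
    fix p assume p: "p \<in> D"
    have "pd (U 0) k p = pd (U 0) G0 p - A (p (U 0)) * h p"
      using pd_outside[OF h, of "U 0" p] p bG0 bh unfolding k_def
      by (simp add: pd_rules base_intros B(8))
    then show "pd (U 0) k p = 0"
      using c1z[OF p] by (simp add: c1_def h_def algebra_simps)
  qed
  have bk: "base k" by (rule base_I[OF k])
  have pdG0: "pd c G0 p = pd c k p + IA (p (U 0)) * pd c h p" if "p \<in> D" "c \<noteq> U 0" for c p
  proof -
    have "pd c G0 p = pd c (\<lambda>p. k p + IA (p (U 0)) * h p) p" by (simp add: k_def)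
    then show ?thesis using that bk bh by (simp add: pd_rules base_intros)
  qed
  \<comment> \<open>The coefficient of u\<integral>A in c0 = 0.\<close>
  define E where "E = (\<lambda>p. \<kappa> * pd V1 f p + \<psi> * pd V2 f p + pd V1 h p + \<phi> (p X) * pd V2 h p)"
  have jE: "jet_on (B 0) E" "jet_on (B 0) (\<lambda>p. pd T f p + pd V1 k p + \<phi> (p X) * pd V2 k p)"
    unfolding E_def by (intro jet_on_add jet_on_mult jet_on_const jet_on_pd jet_on_\<phi> f h k B)+
  have "pd X k p + (pd T f p + pd V1 k p + \<phi> (p X) * pd V2 k p) * p (U 0) + pd X h p * IA (p (U 0))
     + E p * (p (U 0) * IA (p (U 0))) = 0" if "p \<in> D" for p
    using c0z[OF that] by (simp add: c0_def trunc_x_def pdG0[OF that] E_def algebra_simps)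
  note li = lin_indep_B0[OF jfD(2)[OF jet_on_pd[OF k]] jfD(2)[OF jE(2)] jfD(2)[OF jet_on_pd[OF h]] jfD(2)[OF jE(1)] this]
  have hX: "pd X h p = 0" and E0: "E p = 0" if "p \<in> D" for p using li(3,4)[OF _ that] by auto
  have pdh: "pd c h p = pd c (pd X f) p - \<kappa> * pd c f p" if "p \<in> D" for c p
    unfolding h_def using that bf by (simp add: pd_rules base_intros)
  have rho: "\<rho> x * (\<kappa> * \<phi> x - \<psi>) = 1" for x using \<phi>_nz[of x] by (simp add: \<rho>_def)
  \<comment> \<open>h_x = 0 reads f_xx = \<kappa> f_x, so f = b + \<phi> a with a, b free of x;
    differentiating in x gives a = f_x / \<phi>'.\<close>
  define a where "a = (\<lambda>p. \<rho> (p X) * pd X f p)"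
  define b where "b = (\<lambda>p. f p - \<phi> (p X) * a p)"
  have a: "jet_on (B 0) a" unfolding a_def by (intro jet_on_mult jet_on_\<rho> jet_on_pd f B)
  have ba: "base a" by (rule base_I[OF a])
  have b: "jet_on (B 0) b" unfolding b_def by (intro jet_on_mult jet_on_diff jet_on_\<phi> a f B)
  have aX: "pd X a p = 0" if "p \<in> D" for p
    unfolding a_def using that bf hX[OF that] pdh[OF that, of X] by (simp add: pd_rules base_intros base_\<rho> algebra_simps)
  have bX: "pd X b p = 0" if "p \<in> D" for p
  proof -
    have "pd X b p = pd X f p - (\<rho> (p X) * (\<kappa> * \<phi> (p X) - \<psi>)) * pd X f p"
      unfolding b_def using that bf ba aX[OF that]
      by (simp add: pd_rules base_intros base_\<phi>) (simp add: a_def algebra_simps)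
    then show ?thesis by (simp add: rho)
  qed
  \<comment> \<open>E = 0 amounts to f_{x v^1} + \<phi> f_{x v^2} = \<phi>' f_{v^2}; dividing by
    \<phi>' and inserting f = b + \<phi> a leaves closedness.\<close>
  have cl: "pd V1 a p = pd V2 b p" if "p \<in> D" for p
  proof -
    have "pd V1 (pd X f) p + \<phi> (p X) * pd V2 (pd X f) p = (\<kappa> * \<phi> (p X) - \<psi>) * pd V2 f p"
      using E0[OF that] by (simp add: E_def pdh[OF that] algebra_simps)
    then have "\<rho> (p X) * (pd V1 (pd X f) p + \<phi> (p X) * pd V2 (pd X f) p) = pd V2 f p"
      using rho[of "p X"] by (simp add: mult.assoc[symmetric])
    moreover have "pd V1 a p = \<rho> (p X) * pd V1 (pd X f) p" "pd V2 a p = \<rho> (p X) * pd V2 (pd X f) p"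
      unfolding a_def using that bf by (simp_all add: pd_rules base_intros base_\<rho>)
    moreover have "pd V2 b p = pd V2 f p - \<phi> (p X) * pd V2 a p"
      unfolding b_def using that bf ba by (simp add: pd_rules base_intros base_\<phi>)
    ultimately show ?thesis by (simp add: algebra_simps)
  qed
  obtain H where H: "jet_on (B 0) H" "\<And>p. p \<in> D \<Longrightarrow> pd X H p = 0"
    "\<And>p. p \<in> D \<Longrightarrow> pd V1 H p = b p" "\<And>p. p \<in> D \<Longrightarrow> pd V2 H p = a p"
    using potential[OF a b aX bX cl] by blast
  have bH: "base H" by (rule base_I[OF H(1)])
  have "F p - HX H p = 0" if "p \<in> D" for p
    using HX_trunc_x[OF H(1) that] H(2-4)[OF that] Ff[OF that] by (simp add: trunc_x_def b_def)
  then show ?thesis using gauge_triv[OF triv_zero[OF gauge_law[OF l bH]] bH] by blast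
qed

text \<open>The density is affine in u. Its u-free part is removed by an x-primitive, whose
  v-derivatives only change the coefficient of u.\<close>

lemma triv_order0:
  assumes l: "law F G" and F: "jet_on (B (Suc 0)) F"
  shows "triv F G"
proof -
  define f where "f = pd (U 0) F"
  define g where "g = (\<lambda>p. F p - p (U 0) * f p)"
  have f: "jet_on (B 0) f" and g: "jet_on (B 0) g" unfolding g_def f_def by (rule density_split[OF l F])+
  have z: "0 \<in> coord_range X" by (simp add: zero_coord_range)
  define H where "H = prim X 0 g"
  have H: "jet_on (B 0) H" unfolding H_def by (rule jet_on_prim[OF g z]) (simp add: B)
  have bH: "base H" by (rule base_I[OF H])
  have "jet_on (B 0) (\<lambda>p. f p - (pd V1 H p + \<phi> (p X) * pd V2 H p))"
    by (intro jet_on_diff jet_on_add jet_on_mult jet_on_\<phi> jet_on_pd f H B)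
  moreover have "F p - HX H p = p (U 0) * (f p - (pd V1 H p + \<phi> (p X) * pd V2 H p))" if "p \<in> D" for p
    using HX_trunc_x[OF H that] pd_prim_same[OF g z that] by (simp add: trunc_x_def H_def g_def algebra_simps)
  ultimately have "triv (\<lambda>p. F p - HX H p) (\<lambda>p. G p + HT H p)"
    by (rule triv_linear[OF gauge_law[OF l bH]])
  then show ?thesis using bH by (rule gauge_triv)
qed

lemma law_triv: assumes "law F G" shows "triv F G"
proof -
  obtain n where "jet_on (B n) F" using assms by (auto simp: law_def base_def)
  \<comment> \<open>The induction stops at order zero, where \<open>triv_order0\<close> takes over,
    so the bound starts from Suc n.\<close>
  then have "jet_on (B (Suc n)) F" by (rule jet_on_B_mono) simp
  then show ?thesis using assms
  proof (induction n arbitrary: F G)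
    case 0
    then show ?case by (intro triv_order0)
  next
    case (Suc n)
    obtain H where "base H" "jet_on (B (Suc n)) (\<lambda>p. F p - HX H p)"
      using reduce_order[OF Suc.prems(2,1)] .
    then show ?case using Suc.IH gauge_law[OF Suc.prems(2)] gauge_triv by blast
  qed
qed

theorem conservation_laws_trivial:
  assumes "conservation_law 3 D eqs F G"
  shows "trivial_cl 3 D eqs F G"
proof (rule trivial_from_base[OF _ assms])
  fix F G assume "base F" "base G" "\<And>p. p \<in> D \<Longrightarrow> HT F p + HX G p = 0"
  then show "\<exists>H. base H \<and> (\<forall>p\<in>D. F p = HX H p \<and> G p = - HT H p)"
    using law_triv[of F G] by (simp add: law_def triv_def)
qed

end

section \<open>The two systems as instances\<close>

theorem theorem10:
  fixes A IA :: "real \<Rightarrow> real" and I :: "real set"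
  assumes "open I" and "is_interval I" and "I \<noteq> {}"
    and "smooth_real_on I A"
    and "\<forall>u\<in>I. A u \<noteq> 0"
    and "\<not> (\<exists>a. \<forall>u\<in>I. A u = a)"
    and "\<not> (\<exists>a b. \<forall>u\<in>I. A u = a / (u + b)^2)"
    and "\<forall>u\<in>I. (IA has_real_derivative A u) (at u)"
  shows "(\<forall>F G. conservation_law 3 (jdom I) (usys1 A IA) F G
              \<longrightarrow> trivial_cl 3 (jdom I) (usys1 A IA) F G)
       \<and> (\<forall>\<epsilon>\<in>{0, 1, -1::real}. \<forall>F G. conservation_law 3 (jdom I) (usys2 A IA \<epsilon>) F G
              \<longrightarrow> trivial_cl 3 (jdom I) (usys2 A IA \<epsilon>) F G)"
proof (intro conjI ballI allI impI)
  fix F G assume cl: "conservation_law 3 (jdom I) (usys1 A IA) F G"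
  \<comment> \<open>With \<kappa> = 0 and \<psi> = -1 the ODE reads \<phi>' = 1.\<close>
  interpret potential_system I A IA "\<lambda>x. x" 0 "-1"
    by unfold_locales (use assms in \<open>auto intro!: derivative_eq_intros\<close>)
  have "eqs = usys1 A IA"
    by (simp add: eqs_def usys1_def \<tau>1_def \<tau>2_def fun_eq_iff mult.assoc)
  then show "trivial_cl 3 (jdom I) (usys1 A IA) F G"
    using conservation_laws_trivial cl by metis
next
  fix \<epsilon> :: real and F G assume cl: "conservation_law 3 (jdom I) (usys2 A IA \<epsilon>) F G"
  \<comment> \<open>With \<kappa> = 1 and \<psi> = \<epsilon> the right-hand side of the ODE is e^x,
    which never vanishes.\<close>
  interpret potential_system I A IA "\<lambda>x. exp x + \<epsilon>" 1 \<epsilon>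
    by unfold_locales (use assms in \<open>auto intro!: derivative_eq_intros\<close>)
  have "eqs = usys2 A IA \<epsilon>"
    by (simp add: eqs_def usys2_def \<tau>1_def \<tau>2_def fun_eq_iff mult.assoc)
  then show "trivial_cl 3 (jdom I) (usys2 A IA \<epsilon>) F G"
    using conservation_laws_trivial cl by metis
qed

end
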